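(* Let $f^N=\sum_{q=1}^N w_q\,\delta(\cdot-\boldsymbol x_q)$ with positive constant weights $w_q$ and positions $\boldsymbol x_q\in\mathbb{R}^d$. Define the discretized energies $E_A^\varepsilon(\boldsymbol x_1,\dots,\boldsymbol x_N)=E_A^\varepsilon[f^N]$ and $E_L^\varepsilon(\boldsymbol x_1,\dots,\boldsymbol x_N)=E_L^\varepsilon[f^N]$, where $$E_A^\varepsilon[f]=\int_{\mathbb{R}^d}H^\varepsilon(f)+Vf+\tfrac12(W*f)f\,d\boldsymbol x,\qquad E_L^\varepsilon[f]=\int_{\mathbb{R}^d}H^\varepsilon(f)\,d\boldsymbol x .$$ Here, in $E_A^\varepsilon$, $H^\varepsilon(f)$ is either $(f*\varphi_\varepsilon)\log(f*\varphi_\varepsilon)$ or $\frac{1}{m-1}(f*\varphi_\varepsilon)^m$ with $m>1$, and in $E_L^\varepsilon$, $H^\varepsilon(f)=(f*\varphi_\varepsilon)\log(f*\varphi_\varepsilon)$. Then one has, for each $p=1,\dots,N$, $$\frac{1}{w_p}\nabla_{\boldsymbol x_p}E_A^\varepsilon(\boldsymbol x_1,\dots,\boldsymbol x_N)=\nabla_{\boldsymbol x}\frac{\delta E_A^\varepsilon}{\delta f}[f^N](\boldsymbol x_p),\qquad \frac{1}{w_p}\nabla_{\boldsymbol x_p}E_L^\varepsilon(\boldsymbol x_1,\dots,\boldsymbol x_N)=\nabla_{\boldsymbol x}\frac{\delta E_L^\varepsilon}{\delta f}[f^N](\boldsymbol x_p),$$ where the right-hand sides are given by $$\nabla_{\boldsymbol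 x}\frac{\delta E_A^\varepsilon}{\delta f}[f^N](\boldsymbol x_p)=h^\varepsilon(\boldsymbol x_p)+\nabla V(\boldsymbol x_p)+\sum_{q=1}^N w_q\nabla W(\boldsymbol x_p-\boldsymbol x_q),\qquad \nabla_{\boldsymbol x}\frac{\delta E_L^\varepsilon}{\delta f}[f^N](\boldsymbol x_p)=h^\varepsilon(\boldsymbol x_p),$$ with $$h^\varepsilon(\boldsymbol x_p)=\int_{\mathbb{R}^d}(\nabla\varphi_\varepsilon)(\boldsymbol x_p-\boldsymbol x)\log\Big(\sum_{q=1}^N w_q\varphi_\varepsilon(\boldsymbol x-\boldsymbol x_q)\Big)d\boldsymbol x$$ when $H^\varepsilon(f)=(f*\varphi_\varepsilon)\log(f*\varphi_\varepsilon)$, and $$h^\varepsilon(\boldsymbol x_p)=\frac{m}{m-1}\int_{\mathbb{R}^d}(\nabla\varphi_\varepsilon)(\boldsymbol x_p-\boldsymbol x)\Big(\sum_{q=1}^N w_q\varphi_\varepsilon(\boldsymbol x-\boldsymbol x_q)\Big)^{m-1}d\boldsymbol x$$ when $H^\varepsilon(f)=\frac{1}{m-1}(f*\varphi_\varepsilon)^m$.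
   Context: $\varphi_\varepsilon$ is a symmetric mollifier function on $\mathbb{R}^d$ with parameter $\varepsilon$, i.e. $\varphi_\varepsilon(-\boldsymbol x)=\varphi_\varepsilon(\boldsymbol x)$ (often chosen as the Gaussian $\varphi_\varepsilon(\boldsymbol x)=(2\pi\varepsilon)^{-d/2}\exp(-|\boldsymbol x|^2/(2\varepsilon))$). $V(\boldsymbol x)$ is an external potential and $W(\boldsymbol x)$ is a symmetric interaction potential, $W(-\boldsymbol x)=W(\boldsymbol x)$. The functionals are evaluated on $f^N$ by $f^N*\varphi_\varepsilon=\sum_q w_q\varphi_\varepsilon(\cdot-\boldsymbol x_q)$, $\int Vf^N=\sum_q w_qV(\boldsymbol x_q)$, $\int(W*f^N)f^N=\sum_{q,r}w_qw_rW(\boldsymbol x_q-\boldsymbol x_r)$. $\nabla_{\boldsymbol x_p}$ is the gradient with respect to $\boldsymbol x_p$. The variational derivative $\frac{\delta E}{\delta f}[f]$ is defined by $\frac{d}{d\alpha}E[f+\alpha\eta]\big|_{\alpha=0}=\int_{\mathbb{R}^d}\eta\,\frac{\delta E}{\delta f}[f]\,d\boldsymbol x$.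
   Formalization: V and W are assumed differentiable, the mollifier C^1 with it and its gradient locally uniformly dominated; for the log entropy it must also be positive with integrable log bounds, as for compactly supported mollifiers the variational derivative at f^N does not exist. *)

theory Defs
  imports "HOL-Analysis.Analysis"
begin

definition grad :: "('a::euclidean_space \<Rightarrow> real) \<Rightarrow> 'a \<Rightarrow> 'a" where
  "grad f x = (THE D. GDERIV f x :> D)"

text \<open>
  The energies are evaluated at atomic measures and at their perturbations by (signed) densities.
  Both are represented by the functional they induce on functions: \<open>f g\<close> stands for the
  integral of \<open>g\<close> against \<open>f\<close>.
\<close>

type_synonym 'a distr = "('a \<Rightarrow> real) \<Rightarrow> real"

definition atomic :: "nat \<Rightarrow> (nat \<Rightarrow> real) \<Rightarrow> (nat \<Rightarrow> 'a) \<Rightarrow> 'a distr" where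
  "atomic N w x = (\<lambda>g. \<Sum>q=1..N. w q * g (x q))"

definition perturb :: "'a::euclidean_space distr \<Rightarrow> real \<Rightarrow> ('a \<Rightarrow> real) \<Rightarrow> 'a distr" where
  "perturb f \<alpha> \<eta> = (\<lambda>g. f g + \<alpha> * (LINT y|lborel. \<eta> y * g y))"

definition convol :: "'a::euclidean_space distr \<Rightarrow> ('a \<Rightarrow> real) \<Rightarrow> 'a \<Rightarrow> real" where
  "convol f k x = f (\<lambda>y. k (x - y))"

text \<open>
  The two choices of the entropy density, as functions of the mollified density. Arguments are
  nonnegative for nonnegative \<open>f\<close>. A perturbation with a density \<open>\<eta>\<close> can make the mollified
  density negative far away from the atoms (for the Gaussian this happens for arbitrarily small
  parameters); there, since \<open>ln (- s) = ln s\<close> for reals, the formulas below are the extensions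
  \<open>s * ln \<bar>s\<bar>\<close> and \<open>\<bar>s\<bar> powr m / (m - 1)\<close>.
\<close>

definition H_log :: "real \<Rightarrow> real" where
  "H_log s = s * ln s"

definition H_pow :: "real \<Rightarrow> real \<Rightarrow> real" where
  "H_pow m s = 1 / (m - 1) * s powr m"

definition energy_L :: "('a::euclidean_space \<Rightarrow> real) \<Rightarrow> 'a distr \<Rightarrow> real" where
  "energy_L \<phi> f = (LINT x|lborel. H_log (convol f \<phi> x))"

definition energy_A ::
  "(real \<Rightarrow> real) \<Rightarrow> ('a \<Rightarrow> real) \<Rightarrow> ('a \<Rightarrow> real) \<Rightarrow> ('a::euclidean_space \<Rightarrow> real) \<Rightarrow> 'a distr \<Rightarrow> real" where
  "energy_A H V W \<phi> f = (LINT x|lborel. H (convol f \<phi> x)) + f V + 1 / 2 * f (convol f W)"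

text \<open>
  The test functions \<open>\<eta>\<close> are the continuous functions of compact support. The defining identity
  determines the variational derivative only almost everywhere; requiring continuity makes it
  unique and its pointwise gradient meaningful.
\<close>

definition is_variational_derivative ::
  "('a::euclidean_space distr \<Rightarrow> real) \<Rightarrow> 'a distr \<Rightarrow> ('a \<Rightarrow> real) \<Rightarrow> bool" where
  "is_variational_derivative E f D \<longleftrightarrow>
     continuous_on UNIV D \<and>
     (\<forall>\<eta>. continuous_on UNIV \<eta> \<and> compact (closure {x. \<eta> x \<noteq> 0}) \<longrightarrow>
        ((\<lambda>\<alpha>. E (perturb f \<alpha> \<eta>)) has_real_derivative (LINT x|lborel. \<eta> x * D x)) (at 0))"

definition variational_derivative ::
  "('a::euclidean_space distr \<Rightarrow> real) \<Rightarrow> 'a distr \<Rightarrow> 'a \<Rightarrow> real" where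
  "variational_derivative E f = (THE D. is_variational_derivative E f D)"

definition symmetric_mollifier :: "('a::euclidean_space \<Rightarrow> real) \<Rightarrow> bool" where
  "symmetric_mollifier \<phi> \<longleftrightarrow>
     (\<forall>x. \<phi> (- x) = \<phi> x) \<and> (\<forall>x. 0 \<le> \<phi> x) \<and> has_bochner_integral lborel \<phi> 1"

text \<open>
  Regularity under which the integrals in the statement exist. A mollifier is taken to be
  continuously differentiable, with translates \<open>\<phi> (x + y)\<close> and their gradients dominated, locally
  uniformly in \<open>y\<close>, by an integrable function of \<open>x\<close>. This holds for every mollifier of compact
  support and for the Gaussian.
\<close>

definition regular_mollifier :: "('a::euclidean_space \<Rightarrow> real) \<Rightarrow> bool" where
  "regular_mollifier \<phi> \<longleftrightarrow>
     (\<forall>x. \<phi> differentiable (at x)) \<and> continuous_on UNIV (grad \<phi>) \<and>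
     (\<forall>R. \<exists>g. integrable lborel g \<and>
        (\<forall>x y. norm y \<le> R \<longrightarrow> \<phi> (x + y) + norm (grad \<phi> (x + y)) \<le> g x))"

text \<open>
  For the logarithmic entropy the logarithm of the mollified density has to make sense and to be
  integrable against translates of \<open>\<phi>\<close> and of its gradient. The Gaussian qualifies; mollifiers
  of compact support do not, since their logarithmic energy has no finite variational derivative
  at an atomic measure.
\<close>

definition log_regular_mollifier :: "('a::euclidean_space \<Rightarrow> real) \<Rightarrow> bool" where
  "log_regular_mollifier \<phi> \<longleftrightarrow>
     (\<forall>x. 0 < \<phi> x) \<and>
     (\<forall>R. \<exists>g. integrable lborel g \<and>
        (\<forall>x y z. norm y \<le> R \<and> norm z \<le> R \<longrightarrow>
           (\<phi> (x + y) + norm (grad \<phi> (x + y))) * (1 + \<bar>ln (\<phi> (x + z))\<bar>) \<le> g x))"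

definition h_log ::
  "('a::euclidean_space \<Rightarrow> real) \<Rightarrow> nat \<Rightarrow> (nat \<Rightarrow> real) \<Rightarrow> (nat \<Rightarrow> 'a) \<Rightarrow> 'a \<Rightarrow> 'a" where
  "h_log \<phi> N w x z =
     (LINT y|lborel. ln (\<Sum>q=1..N. w q * \<phi> (y - x q)) *\<^sub>R grad \<phi> (z - y))"

definition h_pow ::
  "real \<Rightarrow> ('a::euclidean_space \<Rightarrow> real) \<Rightarrow> nat \<Rightarrow> (nat \<Rightarrow> real) \<Rightarrow> (nat \<Rightarrow> 'a) \<Rightarrow> 'a \<Rightarrow> 'a" where
  "h_pow m \<phi> N w x z = (m / (m - 1)) *\<^sub>R
     (LINT y|lborel. (\<Sum>q=1..N. w q * \<phi> (y - x q)) powr (m - 1) *\<^sub>R grad \<phi> (z - y))"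

end

theory Submission
  imports Defs
begin

text \<open>
  Both gradients are derivatives under the integral sign. Write \<open>\<rho>\<close> for the mollified density of
  the atoms. Perturbing by a density \<open>\<eta>\<close> changes \<open>\<rho>\<close> by \<open>\<alpha>\<close> times the convolution of \<open>\<eta>\<close> and
  \<open>\<phi>\<close>, so by Fubini and the symmetry of \<open>\<phi>\<close> the variational derivative of the entropy is the
  convolution of \<open>\<phi>\<close> with \<open>H' \<circ> \<rho>\<close>. Moving the \<open>p\<close>-th atom changes \<open>\<rho>\<close> by \<open>w p\<close> times a
  difference of translates of \<open>\<phi>\<close>, which gives \<open>w p\<close> times the gradient of the same convolution.
  The limits are dominated because \<open>\<bar>H (\<rho> y + t) - H (\<rho> y)\<bar> \<le> C * \<bar>t\<bar> * K y\<close> for bounded \<open>t\<close>, with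
  \<open>K = 1\<close> for the power law and \<open>K = 1 + \<bar>ln \<rho>\<bar>\<close> for the logarithm; this bound also covers
  perturbations that make the density negative. The constant in \<open>H' = ln + 1\<close> drops out of the
  gradient because \<open>grad \<phi>\<close> has integral zero.
\<close>

section \<open>Gradients and differentiation under the integral sign\<close>

lemma GDERIV_unique:
  assumes "GDERIV f x :> D" "GDERIV f x :> D'"
  shows "D = D'"
proof -
  have "(\<lambda>h. inner h D) = (\<lambda>h. inner h D')"
    using assms unfolding gderiv_def by (rule has_derivative_unique)
  then show ?thesis
    by (meson inner_commute vector_eq_ldot fun_cong)
qed

lemma grad_eq: "GDERIV f x :> D \<Longrightarrow> grad f x = D"
  unfolding grad_def by (blast intro: the_equality GDERIV_unique)

text \<open>Riesz representation in coordinates: the vector representing the derivative collects its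
  values on the basis.\<close>

lemma GDERIV_grad:
  fixes f :: "'a::euclidean_space \<Rightarrow> real"
  assumes "f differentiable (at x)"
  shows "GDERIV f x :> grad f x"
proof -
  from assms obtain f' where f': "(f has_derivative f') (at x)"
    unfolding differentiable_def by blast
  then interpret linear f' by (rule has_derivative_linear)
  have "f' h = inner h (\<Sum>b\<in>Basis. f' b *\<^sub>R b)" for h
  proof -
    have "f' h = f' (\<Sum>b\<in>Basis. inner h b *\<^sub>R b)" by (simp add: euclidean_representation)
    also have "\<dots> = (\<Sum>b\<in>Basis. inner h b * f' b)" by (simp add: sum scale)
    finally show ?thesis by (simp add: inner_sum_right mult.commute)
  qed
  then have "f' = (\<lambda>h. inner h (\<Sum>b\<in>Basis. f' b *\<^sub>R b))" by blast
  then have "GDERIV f x :> (\<Sum>b\<in>Basis. f' b *\<^sub>R b)"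
    using f' unfolding gderiv_def by simp
  then show ?thesis using grad_eq by metis
qed

lemma has_derivative_grad_shift:
  fixes f :: "'a::euclidean_space \<Rightarrow> real"
  assumes "f differentiable (at (y0 - z))"
  shows "((\<lambda>y. f (y - z)) has_derivative (\<lambda>h. inner h (grad f (y0 - z)))) (at y0)"
  using GDERIV_grad[OF assms] unfolding gderiv_def
  by (intro has_derivative_compose[where f = "\<lambda>y. y - z" and g = f, of "\<lambda>h. h"])
    (auto intro!: derivative_eq_intros)

lemma GDERIV_differentiable: "GDERIV f x :> D \<Longrightarrow> f differentiable (at x)"
  unfolding gderiv_def differentiable_def by blast

lemma grad_minus:
  fixes f :: "'a::euclidean_space \<Rightarrow> real"
  assumes "\<And>x. f (- x) = f x" "\<And>x. f differentiable (at x)"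
  shows "grad f (- x) = - grad f x"
proof -
  have "((\<lambda>y. f (- y)) has_derivative (\<lambda>h. inner (- h) (grad f (- x)))) (at x)"
    using GDERIV_grad[OF assms(2), of "- x"] unfolding gderiv_def
    by (intro has_derivative_compose[where f = uminus and g = f, of "\<lambda>h. - h"] derivative_intros) simp_all
  then have "GDERIV f x :> - grad f (- x)"
    unfolding gderiv_def by (simp add: assms(1))
  then show ?thesis by (simp add: grad_eq)
qed

text \<open>Dominated convergence, along sequences, for the remainder quotients of the derivative.
  Derivatives are taken at \<open>y0\<close> only and increments are measured from \<open>y0\<close>
  only. This suits \<open>H_log\<close>, which has no derivative at 0, a value that a perturbed
  density may take.\<close>

lemma GDERIV_integral:
  fixes f :: "'b::euclidean_space \<Rightarrow> 'c \<Rightarrow> real" and G :: "'c \<Rightarrow> 'b"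
  assumes "\<And>y. f y \<in> borel_measurable M" and "integrable M (f y0)"
    and "integrable M G" and "integrable M g"
    and "\<And>x. GDERIV (\<lambda>y. f y x) y0 :> G x"
    and "r > 0"
    and "\<And>x y. norm (y - y0) \<le> r \<Longrightarrow> \<bar>f y x - f y0 x\<bar> \<le> norm (y - y0) * g x"
  shows "GDERIV (\<lambda>y. LINT x|M. f y x) y0 :> (LINT x|M. G x)"
proof -
  let ?q = "\<lambda>y x. ((f y x - f y0 x) - inner (y - y0) (G x)) /\<^sub>R norm (y - y0)"
  have int: "integrable M (f y)" if "norm (y - y0) \<le> r" for y
  proof -
    have "integrable M (\<lambda>x. f y x - f y0 x)"
    proof (rule Bochner_Integration.integrable_bound)
      show "integrable M (\<lambda>x. norm (y - y0) * g x)" using assms(4) by simp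
      show "(\<lambda>x. f y x - f y0 x) \<in> borel_measurable M" using assms(1) by measurable
      show "AE x in M. norm (f y x - f y0 x) \<le> norm (norm (y - y0) * g x)"
        using assms(7)[OF that] by (intro AE_I2) (smt (verit) real_norm_def)
    qed
    from Bochner_Integration.integrable_add[OF this assms(2)] show ?thesis by simp
  qed
  have "((\<lambda>y. LINT x|M. ?q y x) \<longlongrightarrow> (LINT x|M. 0)) (at y0)"
    unfolding tendsto_at_iff_sequentially comp_def
  proof (intro allI impI)
    fix X assume X: "\<forall>i. X i \<in> UNIV - {y0}" "X \<longlonglongrightarrow> y0"
    from X(2) have "eventually (\<lambda>n. dist (X n) y0 < r) sequentially"
      using \<open>r > 0\<close> by (rule tendstoD)
    then obtain N where N: "\<And>n. n \<ge> N \<Longrightarrow> norm (X n - y0) \<le> r"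
      unfolding eventually_sequentially by (auto simp: dist_norm intro: less_imp_le)
    \<comment> \<open>Shifting by \<open>N\<close> makes the increment bound available at every
      index; \<open>LIMSEQ_offset\<close> removes the shift afterwards.\<close>
    have "(\<lambda>n. LINT x|M. ?q (X (n + N)) x) \<longlonglongrightarrow> (LINT x|M. 0)"
    proof (rule integral_dominated_convergence)
      show "integrable M (\<lambda>x. g x + norm (G x))" using assms by simp
      show "?q (X (n + N)) \<in> borel_measurable M" for n
        using assms(1) borel_measurable_integrable[OF assms(3)] by measurable
      have "norm (?q (X (n + N)) x) \<le> g x + norm (G x)" for n x
      proof -
        let ?y = "X (n + N)"
        have pos: "norm (?y - y0) > 0" using X(1) by auto
        have "\<bar>f ?y x - f y0 x - inner (?y - y0) (G x)\<bar> \<le> norm (?y - y0) * (g x + norm (G x))"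
          using assms(7)[OF N[of "n + N"], of x] Cauchy_Schwarz_ineq2[of "?y - y0" "G x"]
          by (simp add: algebra_simps)
        then show ?thesis using pos by (simp add: field_simps abs_mult)
      qed
      then show "AE x in M. norm (?q (X (n + N)) x) \<le> g x + norm (G x)" for n by simp
      have "(\<lambda>n. ?q (X n) x) \<longlonglongrightarrow> 0" for x
        using assms(5)[of x] X unfolding gderiv_def has_derivative_at_within tendsto_at_iff_sequentially
        by (simp add: comp_def)
      then show "AE x in M. (\<lambda>n. ?q (X (n + N)) x) \<longlonglongrightarrow> 0"
        by (intro AE_I2 LIMSEQ_ignore_initial_segment)
    qed simp
    then show "(\<lambda>n. LINT x|M. ?q (X n) x) \<longlonglongrightarrow> (LINT x|M. 0)"
      by (rule LIMSEQ_offset)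
  qed
  \<comment> \<open>Linearity of the integral is applied where \<open>f y\<close> is known to be
    integrable, within distance \<open>r\<close> of \<open>y0\<close>; hence the identity is stated
    eventually.\<close>
  moreover have "eventually (\<lambda>y. (LINT x|M. ?q y x) =
    (((LINT x|M. f y x) - (LINT x|M. f y0 x)) - inner (y - y0) (LINT x|M. G x)) /\<^sub>R norm (y - y0)) (at y0)"
    unfolding eventually_at
  proof (intro exI[of _ r] conjI ballI impI)
    fix y assume "y \<noteq> y0 \<and> dist y y0 < r"
    then have "integrable M (f y)" by (intro int) (simp add: dist_norm)
    then show "(LINT x|M. ?q y x) =
      (((LINT x|M. f y x) - (LINT x|M. f y0 x)) - inner (y - y0) (LINT x|M. G x)) /\<^sub>R norm (y - y0)"
      using assms(2,3) by simp
  qed fact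
  ultimately show ?thesis
    unfolding gderiv_def
    by (intro has_derivativeI bounded_linear_inner_left) (auto elim: Lim_transform_eventually)
qed

section \<open>Uniqueness of the variational derivative\<close>

lemma integrable_compact_support:
  fixes f :: "'a::euclidean_space \<Rightarrow> real"
  assumes "continuous_on UNIV f" "compact S" "\<And>x. x \<notin> S \<Longrightarrow> f x = 0"
  shows "integrable lborel f"
proof -
  have "integrable lborel (\<lambda>x. indicator S x *\<^sub>R f x)"
    using assms by (intro borel_integrable_compact) (auto intro: continuous_on_subset)
  also have "(\<lambda>x. indicator S x *\<^sub>R f x) = f"
    using assms(3) by (auto simp: indicator_def fun_eq_iff)
  finally show ?thesis .
qed

text \<open>A nonempty open set contains a ball, and balls have positive Lebesgue measure.\<close>

lemma continuous_AE_eq_0: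
  fixes f :: "'a::euclidean_space \<Rightarrow> real"
  assumes "continuous_on UNIV f" "AE x in lborel. f x = 0"
  shows "f z = 0"
proof (rule ccontr)
  assume z: "f z \<noteq> 0"
  have "open {x. f x \<noteq> 0}"
    using assms(1) by (intro open_Collect_neq continuous_intros)
  then obtain r where r: "r > 0" "ball z r \<subseteq> {x. f x \<noteq> 0}"
    using z by (auto simp: open_contains_ball)
  have "AE x in lborel. x \<notin> ball z r"
    using assms(2) by eventually_elim (use r in auto)
  then have "emeasure lborel (ball z r) = 0"
    by (subst (asm) AE_iff_measurable[where N = "ball z r"]) auto
  then have "measure lborel (ball z r) = 0" by (simp add: measure_def)
  with content_ball_pos[OF r(1), of z] show False by simp
qed

text \<open>Testing the difference of the two candidates against itself, cut off by a bump, gives a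
  nonnegative continuous function with vanishing integral. This justifies the definite description
  in \<open>variational_derivative\<close>.\<close>

lemma is_variational_derivative_unique:
  fixes E :: "'a::euclidean_space distr \<Rightarrow> real"
  assumes "is_variational_derivative E f D" "is_variational_derivative E f D'"
  shows "D = D'"
proof
  fix z
  \<comment> \<open>The tent \<open>?b\<close> is 1 at \<open>z\<close> and vanishes outside the
    unit ball about \<open>z\<close>, so \<open>?\<eta>\<close> is an admissible test function
    whatever the supports of \<open>D\<close> and \<open>D'\<close>.\<close>
  let ?b = "\<lambda>y::'a. max 0 (1 - dist y z)" and ?\<delta> = "\<lambda>y. D y - D' y"
  let ?\<eta> = "\<lambda>y. ?b y * ?\<delta> y"
  from assms have cont [continuous_intros]: "continuous_on UNIV D" "continuous_on UNIV D'"
    by (simp_all add: is_variational_derivative_def)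
  have \<eta>: "continuous_on UNIV ?\<eta>" by (intro continuous_intros)
  have zero: "?\<eta> y = 0" if "y \<notin> cball z 1" for y
    using that by (simp add: dist_commute)
  have "closure {y. ?\<eta> y \<noteq> 0} \<subseteq> cball z 1"
    by (rule closure_minimal) (use zero in blast, simp)
  then have "compact (closure {y. ?\<eta> y \<noteq> 0})"
    by (meson bounded_cball bounded_subset closed_closure compact_eq_bounded_closed)
  with \<eta> assms have "(LINT y|lborel. ?\<eta> y * D y) = (LINT y|lborel. ?\<eta> y * D' y)"
    unfolding is_variational_derivative_def by (blast intro: DERIV_unique)
  moreover have "integrable lborel (\<lambda>y. ?\<eta> y * D y)" "integrable lborel (\<lambda>y. ?\<eta> y * D' y)"
    using zero
    by (auto intro!: integrable_compact_support[where S = "cball z 1"] continuous_intros)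
  ultimately have "(LINT y|lborel. ?\<eta> y * D y - ?\<eta> y * D' y) = 0" by simp
  moreover have "(\<lambda>y. ?\<eta> y * D y - ?\<eta> y * D' y) = (\<lambda>y. ?b y * (?\<delta> y)\<^sup>2)"
    by (simp add: fun_eq_iff power2_eq_square algebra_simps)
  ultimately have "(LINT y|lborel. ?b y * (?\<delta> y)\<^sup>2) = 0" by simp
  moreover have "integrable lborel (\<lambda>y. ?b y * (?\<delta> y)\<^sup>2)"
    using zero
    by (auto intro!: integrable_compact_support[where S = "cball z 1"] continuous_intros)
  ultimately have "AE y in lborel. ?b y * (?\<delta> y)\<^sup>2 = 0"
    by (subst (asm) integral_nonneg_eq_0_iff_AE) auto
  then have "?b z * (?\<delta> z)\<^sup>2 = 0"
    by (intro continuous_AE_eq_0[of "\<lambda>y. ?b y * (?\<delta> y)\<^sup>2"] continuous_intros)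
  then show "D z = D' z" by simp
qed

lemma variational_derivative_eq:
  "is_variational_derivative E f D \<Longrightarrow> variational_derivative E f = D"
  unfolding variational_derivative_def
  by (blast intro: the_equality is_variational_derivative_unique)

section \<open>Additivity, and the potential and interaction energies\<close>

lemma is_variational_derivative_add:
  fixes D1 :: "'a::euclidean_space \<Rightarrow> real"
  assumes "is_variational_derivative E1 f D1" "is_variational_derivative E2 f D2"
  shows "is_variational_derivative (\<lambda>f. E1 f + E2 f) f (\<lambda>y. D1 y + D2 y)"
  unfolding is_variational_derivative_def
proof (intro conjI allI impI)
  from assms have cont: "continuous_on UNIV D1" "continuous_on UNIV D2"
    by (simp_all add: is_variational_derivative_def)
  then show "continuous_on UNIV (\<lambda>y. D1 y + D2 y)" by (intro continuous_intros)
  fix \<eta> :: "'a \<Rightarrow> real"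
  assume \<eta>: "continuous_on UNIV \<eta> \<and> compact (closure {x. \<eta> x \<noteq> 0})"
  \<comment> \<open>Compact support of \<eta> makes its product with any continuous function
    integrable, so the integral of the sum can be split.\<close>
  have int: "integrable lborel (\<lambda>y. \<eta> y * D y)" if "continuous_on UNIV D" for D
    using \<eta> that closure_subset[of "{x. \<eta> x \<noteq> 0}"]
    by (intro integrable_compact_support[where S = "closure {x. \<eta> x \<noteq> 0}"])
      (auto intro!: continuous_intros)
  have "(LINT y|lborel. \<eta> y * (D1 y + D2 y)) =
      (LINT y|lborel. \<eta> y * D1 y) + (LINT y|lborel. \<eta> y * D2 y)"
    using int[OF cont(1)] int[OF cont(2)] by (simp add: distrib_left)
  then show "((\<lambda>\<alpha>. E1 (perturb f \<alpha> \<eta>) + E2 (perturb f \<alpha> \<eta>)) has_real_derivative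
      (LINT y|lborel. \<eta> y * (D1 y + D2 y))) (at 0)"
    using assms \<eta> by (auto simp: is_variational_derivative_def intro!: DERIV_add)
qed

text \<open>Along a perturbation the energy is a quadratic polynomial in \<alpha>, and its linear
  coefficient is the derivative at 0. The two mixed interaction terms agree because \<open>W\<close>
  is even, which cancels the factor 1/2.\<close>

lemma is_variational_derivative_potential:
  fixes V W :: "'a::euclidean_space \<Rightarrow> real"
  assumes V [continuous_intros]: "continuous_on UNIV V"
    and W: "continuous_on UNIV W" and even: "\<And>z. W (- z) = W z"
  shows "is_variational_derivative (\<lambda>f. f V + 1 / 2 * f (convol f W)) (atomic N w x)
    (\<lambda>y. V y + (\<Sum>q=1..N. w q * W (y - x q)))"
  unfolding is_variational_derivative_def
proof (intro conjI allI impI)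
  have W' [continuous_intros]: "continuous_on S (\<lambda>y. W (f y))"
    if "continuous_on S f" for S and f :: "'b::topological_space \<Rightarrow> 'a"
    using continuous_on_compose2[OF W that] by simp
  show "continuous_on UNIV (\<lambda>y. V y + (\<Sum>q=1..N. w q * W (y - x q)))"
    by (intro continuous_intros)
  fix \<eta> :: "'a \<Rightarrow> real"
  assume "continuous_on UNIV \<eta> \<and> compact (closure {x. \<eta> x \<noteq> 0})"
  then have \<eta> [continuous_intros]: "continuous_on UNIV \<eta>"
    and "compact (closure {x. \<eta> x \<noteq> 0})" by auto
  moreover have "\<eta> y = 0" if "y \<notin> closure {x. \<eta> x \<noteq> 0}" for y
    using that closure_subset[of "{x. \<eta> x \<noteq> 0}"] by auto
  ultimately obtain S where S: "compact S" "\<And>y. y \<notin> S \<Longrightarrow> \<eta> y = 0" by blast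
  have int: "integrable lborel (\<lambda>y. \<eta> y * D y)" if "continuous_on UNIV D" for D
    using S that \<eta> by (intro integrable_compact_support[where S = S] continuous_intros) auto
  let ?A = "\<lambda>y. \<Sum>q=1..N. w q * W (y - x q)"
  let ?g = "\<lambda>y. LINT z|lborel. \<eta> z * W (y - z)"
  have A: "integrable lborel (\<lambda>y. \<eta> y * ?A y)"
    by (intro int continuous_intros)
  \<comment> \<open>On the product space the integrand is continuous and supported in
    \<open>S \<times> S\<close>. Joint integrability then gives integrability of \<eta> times its
    own interaction potential.\<close>
  have "integrable (lborel \<Otimes>\<^sub>M lborel) (\<lambda>(y, z). \<eta> y * (\<eta> z * W (y - z)))"
    unfolding lborel_prod case_prod_beta
  proof (rule integrable_compact_support[where S = "S \<times> S"])
    have [continuous_intros]: "continuous_on T (\<lambda>y. \<eta> (f y))"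
      if "continuous_on T f" for T and f :: "'a \<times> 'a \<Rightarrow> 'a"
      using continuous_on_compose2[OF \<eta> that] by simp
    show "continuous_on UNIV (\<lambda>p. \<eta> (fst p) * (\<eta> (snd p) * W (fst p - snd p)))"
      by (intro continuous_intros)
    show "compact (S \<times> S)" using S(1) by (intro compact_Times)
    show "\<eta> (fst p) * (\<eta> (snd p) * W (fst p - snd p)) = 0" if "p \<notin> S \<times> S" for p
      using that S(2)[of "fst p"] S(2)[of "snd p"] by (cases p) auto
  qed
  from lborel_pair.integrable_fst'[OF this]
  have g: "integrable lborel (\<lambda>y. \<eta> y * ?g y)" by simp
  \<comment> \<open>The atoms paired with the potential of \<eta>, against \<eta> paired with the
    potential of the atoms.\<close>
  have sym: "(\<Sum>q=1..N. w q * ?g (x q)) = (LINT y|lborel. \<eta> y * ?A y)"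
  proof -
    have "(LINT y|lborel. \<eta> y * ?A y) = (LINT y|lborel. (\<Sum>q=1..N. w q * (\<eta> y * W (x q - y))))"
      by (intro Bochner_Integration.integral_cong refl)
        (simp add: sum_distrib_left mult.left_commute even[of "y - x q" for y q, simplified])
    also have "\<dots> = (\<Sum>q=1..N. w q * ?g (x q))"
      by (subst Bochner_Integration.integral_sum)
        (auto intro!: int continuous_intros integrable_mult_right)
    finally show ?thesis ..
  qed
  \<comment> \<open>The coefficients of the quadratic polynomial: \<open>c\<close> is the mixed
    interaction, \<open>d\<close> the self-interaction of \<eta>, \<open>b\<close> the pairing with
    \<open>V\<close>, and \<open>s\<close> the self-interaction of the atoms.\<close>
  define c where "c = (LINT y|lborel. \<eta> y * ?A y)"
  define d where "d = (LINT y|lborel. \<eta> y * ?g y)"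
  define b where "b = (LINT y|lborel. \<eta> y * V y)"
  define s where "s = (\<Sum>q=1..N. w q * ?A (x q))"
  have eq: "perturb (atomic N w x) \<alpha> \<eta> V +
      1 / 2 * perturb (atomic N w x) \<alpha> \<eta> (convol (perturb (atomic N w x) \<alpha> \<eta>) W) = atomic N w x V + \<alpha> * b + 1 / 2 * (s + 2 * \<alpha> * c + \<alpha>\<^sup>2 * d)" for \<alpha>
  proof -
    have "convol (perturb (atomic N w x) \<alpha> \<eta>) W = (\<lambda>y. ?A y + \<alpha> * ?g y)"
      by (simp add: convol_def perturb_def atomic_def fun_eq_iff)
    moreover have "atomic N w x (\<lambda>y. ?A y + \<alpha> * ?g y) = s + \<alpha> * c"
      unfolding atomic_def s_def c_def sym[symmetric]
      by (simp add: distrib_left sum.distrib sum_distrib_left mult.left_commute)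
    moreover have "(LINT y|lborel. \<eta> y * (?A y + \<alpha> * ?g y)) = c + \<alpha> * d"
    proof -
      have "(LINT y|lborel. \<eta> y * (?A y + \<alpha> * ?g y)) = (LINT y|lborel. \<eta> y * ?A y + \<alpha> * (\<eta> y * ?g y))"
        by (intro Bochner_Integration.integral_cong) (auto simp: algebra_simps)
      then show ?thesis using A g by (simp add: c_def d_def)
    qed
    ultimately show ?thesis
      unfolding perturb_def by (simp add: b_def power2_eq_square algebra_simps)
  qed
  have "(LINT y|lborel. \<eta> y * (V y + ?A y)) = b + c"
    using A int[OF V] by (simp add: b_def c_def distrib_left)
  then show "((\<lambda>\<alpha>. perturb (atomic N w x) \<alpha> \<eta> V +
        1 / 2 * perturb (atomic N w x) \<alpha> \<eta> (convol (perturb (atomic N w x) \<alpha> \<eta>) W))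
      has_real_derivative (LINT y|lborel. \<eta> y * (V y + ?A y))) (at 0)"
    unfolding eq by (auto intro!: derivative_eq_intros)
qed

text \<open>A moving particle enters the double sum through both indices. As \<open>grad W\<close>
  is odd, the two contributions are equal and cancel the factor 1/2. Oddness also gives
  \<open>grad W 0 = 0\<close>, so the summand \<open>q = p\<close> contributes nothing.\<close>

lemma GDERIV_potential:
  fixes V W :: "'a::euclidean_space \<Rightarrow> real"
  assumes V: "\<And>z. V differentiable (at z)"
    and W: "\<And>z. W differentiable (at z)" and even: "\<And>z. W (- z) = W z"
    and p: "p \<in> {1..N}"
  shows "GDERIV (\<lambda>y. atomic N w (x(p := y)) V +
      1 / 2 * atomic N w (x(p := y)) (convol (atomic N w (x(p := y))) W)) (x p) :>
    w p *\<^sub>R (grad V (x p) + (\<Sum>q=1..N. w q *\<^sub>R grad W (x p - x q)))"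
proof -
  let ?G = "\<lambda>q r. grad W (x q - x r)"
  \<comment> \<open>The derivative of the position of particle \<open>q\<close> when particle
    \<open>p\<close> moves.\<close>
  let ?h = "\<lambda>q h. if q = p then h else 0"
  have X: "((\<lambda>y. (x(p := y)) q) has_derivative ?h q) (at (x p))" for q
    by (cases "q = p") (simp_all add: has_derivative_ident)
  have dV: "((\<lambda>y. V ((x(p := y)) q)) has_derivative (\<lambda>h. inner (?h q h) (grad V (x q)))) (at (x p))" for q
    using has_derivative_compose[OF X, of V "\<lambda>h. inner h (grad V (x q))" q] GDERIV_grad[OF V, of "x q"]
    by (simp add: gderiv_def)
  have dW: "((\<lambda>y. W ((x(p := y)) q - (x(p := y)) r)) has_derivative
      (\<lambda>h. inner (?h q h - ?h r h) (?G q r))) (at (x p))" for q r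
    using has_derivative_compose[OF has_derivative_diff[OF X X], of W "\<lambda>h. inner h (?G q r)" q r]
      GDERIV_grad[OF W, of "x q - x r"]
    by (simp add: gderiv_def)
  have G: "?G r q = - ?G q r" for q r
    using grad_minus[OF even W, of "x q - x r"] by simp
  have sumV: "(\<Sum>q=1..N. w q * inner (?h q h) (grad V (x q))) = inner h (w p *\<^sub>R grad V (x p))" for h
  proof -
    have "(\<Sum>q=1..N. w q * inner (?h q h) (grad V (x q))) =
        (\<Sum>q=1..N. if q = p then w q * inner h (grad V (x q)) else 0)"
      by (intro sum.cong) auto
    then show ?thesis using p by (simp add: sum.delta)
  qed
  have sumW: "(\<Sum>q=1..N. w q * (\<Sum>r=1..N. w r * inner (?h q h - ?h r h) (?G q r))) =
      2 * inner h (w p *\<^sub>R (\<Sum>q=1..N. w q *\<^sub>R ?G p q))" for h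
  proof -
    have "(\<Sum>q=1..N. w q * (\<Sum>r=1..N. w r * inner (?h q h - ?h r h) (?G q r))) =
        (\<Sum>q=1..N. \<Sum>r=1..N. w q * (w r * inner (?h q h) (?G q r))) -
        (\<Sum>q=1..N. \<Sum>r=1..N. w q * (w r * inner (?h r h) (?G q r)))"
      by (simp add: sum_distrib_left sum_subtractf[symmetric] inner_diff_left algebra_simps)
    \<comment> \<open>Exchanging the indices and using oddness turns the second double sum into
      minus the first; there only the row of particle \<open>p\<close> survives.\<close>
    also have "(\<Sum>q=1..N. \<Sum>r=1..N. w q * (w r * inner (?h r h) (?G q r))) =
        (\<Sum>r=1..N. \<Sum>q=1..N. w q * (w r * inner (?h r h) (?G q r)))"
      by (rule sum.swap)
    also have "\<dots> = - (\<Sum>r=1..N. \<Sum>q=1..N. w r * (w q * inner (?h r h) (?G r q)))"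
      unfolding sum_negf[symmetric]
      by (intro sum.cong refl) (subst G, simp add: mult.left_commute)
    also have "(\<Sum>q=1..N. \<Sum>r=1..N. w q * (w r * inner (?h q h) (?G q r))) =
        (\<Sum>q=1..N. if q = p then (\<Sum>r=1..N. w q * (w r * inner h (?G q r))) else 0)"
      by (intro sum.cong) auto
    also have "\<dots> = inner h (w p *\<^sub>R (\<Sum>q=1..N. w q *\<^sub>R ?G p q))"
      using p by (simp add: sum.delta inner_sum_right sum_distrib_left)
    finally show ?thesis by simp
  qed
  have "((\<lambda>y. (\<Sum>q=1..N. w q * V ((x(p := y)) q)) + 1 / 2 * (\<Sum>q=1..N. w q *
        (\<Sum>r=1..N. w r * W ((x(p := y)) q - (x(p := y)) r)))) has_derivative
      (\<lambda>h. (\<Sum>q=1..N. w q * inner (?h q h) (grad V (x q))) + 1 / 2 * (\<Sum>q=1..N. w q *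
        (\<Sum>r=1..N. w r * inner (?h q h - ?h r h) (?G q r))))) (at (x p))"
    by (intro has_derivative_add has_derivative_sum has_derivative_mult_right dV dW)
  then show ?thesis
    unfolding gderiv_def atomic_def convol_def sumV sumW by (simp add: inner_add_right algebra_simps)
qed

section \<open>Mollifiers, and the derivatives of an abstract mollified entropy\<close>

lemma mollifier_bounded:
  assumes "symmetric_mollifier \<phi>" "regular_mollifier \<phi>"
  shows "\<exists>B. \<forall>x. \<phi> x \<le> B"
proof -
  have nonneg: "0 \<le> \<phi> x" for x using assms(1) by (simp add: symmetric_mollifier_def)
  from assms(2) obtain g where g: "integrable lborel g"
    "\<And>x y. norm y \<le> 1 \<Longrightarrow> \<phi> (x + y) + norm (grad \<phi> (x + y)) \<le> g x"
    unfolding regular_mollifier_def by blast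
  have le_g: "\<phi> (x + y) \<le> g x" if "norm y \<le> 1" for x y
    using g(2)[OF that, of x] norm_ge_zero[of "grad \<phi> (x + y)"] by linarith
  \<comment> \<open>On the unit ball about \<open>z\<close>, the value \<open>\<phi> z\<close> is
    reached from \<open>x\<close> by a translation of length at most 1 and so lies below
    \<open>g x\<close>; elsewhere \<open>g\<close> is nonnegative. Integrating bounds
    \<open>\<phi> z\<close> independently of \<open>z\<close>.\<close>
  let ?c = "measure lborel (ball (0::'a) 1)"
  have "\<phi> z * ?c \<le> (LINT x|lborel. g x)" for z
  proof -
    have le: "\<phi> z * indicator (ball z 1) x \<le> g x" for x
    proof (cases "x \<in> ball z 1")
      case True
      then show ?thesis using le_g[of "z - x" x] by (simp add: dist_norm)
    next
      case False
      then show ?thesis using le_g[of 0 x] nonneg[of x] by simp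
    qed
    have "integrable lborel (\<lambda>x. \<phi> z * indicator (ball z 1) x :: real)"
      by (intro integrable_mult_right integrable_real_indicator[OF _ emeasure_lborel_ball_finite]) simp
    then have "(LINT x|lborel. \<phi> z * indicator (ball z 1) x) \<le> (LINT x|lborel. g x)"
      using g(1) le by (intro integral_mono)
    moreover have "measure lborel (ball z 1) = ?c"
      by (simp add: content_ball)
    ultimately show ?thesis by simp
  qed
  moreover have "?c > 0" by (simp add: content_ball_pos)
  ultimately have "\<phi> z \<le> (LINT x|lborel. g x) / ?c" for z
    by (simp add: field_simps)
  then show ?thesis by blast
qed

text \<open>An affine map with factor -1 preserves Lebesgue measure.\<close>

lemma integral_reflect_translate:
  fixes f :: "'a::euclidean_space \<Rightarrow> real"
  assumes [measurable]: "f \<in> borel_measurable borel"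
  shows "(LINT x|lborel. f (y - x)) = (LINT x|lborel. f x)"
proof -
  have "(lborel :: 'a measure) = distr lborel borel (\<lambda>x. y - x)"
    using lborel_affine[of "-1" y] by (simp add: density_1)
  then have "(LINT x|lborel. f x) = (LINT x|distr lborel borel (\<lambda>x. y - x). f x)"
    by simp
  also have "\<dots> = (LINT x|lborel. f (y - x))"
    by (rule integral_distr) measurable
  finally show ?thesis ..
qed

lemma mollifier_continuous: "regular_mollifier \<phi> \<Longrightarrow> continuous_on UNIV \<phi>"
  unfolding regular_mollifier_def
  by (meson continuous_at_imp_continuous_on differentiable_imp_continuous_within)

text \<open>Here \<open>a\<close> is \<open>H'\<close> along the density, and \<open>K\<close> is a
  common weight: it controls \<open>a\<close> and the increments of \<open>H\<close> from \<rho>,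
  while translates of \<phi> and of its gradient remain dominated after multiplication by it.
  \<open>H_lip\<close> admits \<open>t\<close> of either sign, since a perturbed density can become
  negative. \<open>K_ge_1\<close> lets constant weights be treated like \<open>a\<close>.\<close>

locale mollified_entropy =
  fixes \<phi> :: "'a::euclidean_space \<Rightarrow> real" and H :: "real \<Rightarrow> real"
    and N :: nat and w :: "nat \<Rightarrow> real" and x :: "nat \<Rightarrow> 'a"
    and \<rho> a K :: "'a \<Rightarrow> real"
  assumes mollifier: "symmetric_mollifier \<phi>" "regular_mollifier \<phi>"
    and \<rho>_eq: "\<And>y. \<rho> y = (\<Sum>q=1..N. w q * \<phi> (y - x q))"
    and meas [measurable]: "a \<in> borel_measurable borel" "H \<in> borel_measurable borel"
    and H_0: "H 0 = 0"
    and H_deriv: "\<And>y. DERIV H (\<rho> y) :> a y"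
    and K_ge_1: "\<And>y. 1 \<le> K y"
    and a_le: "\<exists>C. \<forall>y. \<bar>a y\<bar> \<le> C * K y"
    and H_lip: "\<And>M. \<exists>C. \<forall>y t. \<bar>t\<bar> \<le> M \<longrightarrow> \<bar>H (\<rho> y + t) - H (\<rho> y)\<bar> \<le> C * \<bar>t\<bar> * K y"
    and dom: "\<And>R. \<exists>g. integrable lborel g \<and>
      (\<forall>y z. norm z \<le> R \<longrightarrow> (\<phi> (y + z) + norm (grad \<phi> (y + z))) * K y \<le> g y)"
begin

lemma \<phi>_diff: "\<phi> differentiable (at y)" and grad_cont: "continuous_on UNIV (grad \<phi>)"
  and \<phi>_even: "\<phi> (- y) = \<phi> y" and \<phi>_nonneg: "0 \<le> \<phi> y"
  using mollifier by (auto simp: regular_mollifier_def symmetric_mollifier_def)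

lemma K_pos: "0 < K y"
  using K_ge_1[of y] by simp

lemma \<phi>_measurable [measurable]:
  "\<phi> \<in> borel_measurable borel" "grad \<phi> \<in> borel_measurable borel"
  using mollifier_continuous[OF mollifier(2)] grad_cont by (auto intro: borel_measurable_continuous_onI)

lemma \<phi>_sym: "\<phi> (y - z) = \<phi> (z - y)"
  using \<phi>_even[of "z - y"] by simp

text \<open>Adapts \<open>dom\<close> to the reflected translates that occur in convolutions: \<phi>
  is even and its gradient odd, so the norms do not change. Both summands are nonnegative and can be
  bounded separately.\<close>

lemma dominator:
  obtains g where "integrable lborel g"
    "\<And>x y. norm y \<le> R \<Longrightarrow> \<phi> (y - x) * K x \<le> g x"
    "\<And>x y. norm y \<le> R \<Longrightarrow> norm (grad \<phi> (y - x)) * K x \<le> g x"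
proof -
  from dom[of R] obtain g where g: "integrable lborel g"
    "\<And>x y. norm y \<le> R \<Longrightarrow> (\<phi> (x + y) + norm (grad \<phi> (x + y))) * K x \<le> g x" by blast
  have "\<phi> (y - x) * K x \<le> g x \<and> norm (grad \<phi> (y - x)) * K x \<le> g x" if "norm y \<le> R" for x y
  proof -
    have "grad \<phi> (y - x) = - grad \<phi> (x - y)"
      using grad_minus[of \<phi> "x - y"] \<phi>_even \<phi>_diff by simp
    then have "(\<phi> (y - x) + norm (grad \<phi> (y - x))) * K x \<le> g x"
      using g(2)[of "- y" x] that by (simp add: \<phi>_sym)
    moreover have "0 \<le> \<phi> (y - x) * K x" "0 \<le> norm (grad \<phi> (y - x)) * K x"
      using K_pos[of x] \<phi>_nonneg by simp_all
    ultimately show ?thesis by (simp add: distrib_right)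
  qed
  with g(1) show ?thesis using that by blast
qed

text \<open>Mean value inequality on the unit ball about \<open>y0\<close>. The radius
  \<open>norm y0 + 1\<close> covers that ball, so one integrable function dominates all the weighted
  gradients.\<close>

lemma \<phi>_local_lipschitz:
  obtains g where "integrable lborel g"
    "\<And>x y. norm (y - y0) \<le> 1 \<Longrightarrow> \<bar>\<phi> (y - x) - \<phi> (y0 - x)\<bar> * K x \<le> norm (y - y0) * g x"
proof -
  obtain g where g: "integrable lborel g"
    "\<And>x y. norm y \<le> norm y0 + 1 \<Longrightarrow> norm (grad \<phi> (y - x)) * K x \<le> g x"
    using dominator[of "norm y0 + 1"] by metis
  have "\<bar>\<phi> (y - x) - \<phi> (y0 - x)\<bar> * K x \<le> norm (y - y0) * g x" if y: "norm (y - y0) \<le> 1" for x y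
  proof -
    have "norm (\<phi> (y - x) - \<phi> (y0 - x)) \<le> (g x / K x) * norm (y - y0)"
    proof (rule differentiable_bound[where S = "cball y0 1"
          and f' = "\<lambda>y h. inner h (grad \<phi> (y - x))"])
      fix z assume z: "z \<in> cball y0 1"
      show "((\<lambda>y. \<phi> (y - x)) has_derivative (\<lambda>h. inner h (grad \<phi> (z - x)))) (at z within cball y0 1)"
        by (rule has_derivative_at_withinI[OF has_derivative_grad_shift[OF \<phi>_diff]])
      have "norm z \<le> norm y0 + 1"
        using z norm_triangle_ineq4[of y0 "y0 - z"] by (simp add: dist_norm)
      from g(2)[OF this, of x] have le: "norm (grad \<phi> (z - x)) \<le> g x / K x"
        using K_pos[of x] by (simp add: field_simps)
      show "onorm (\<lambda>h. inner h (grad \<phi> (z - x))) \<le> g x / K x"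
      proof (rule onorm_le)
        fix h
        have "norm (inner h (grad \<phi> (z - x))) \<le> norm h * norm (grad \<phi> (z - x))"
          using Cauchy_Schwarz_ineq2 by simp
        also have "\<dots> \<le> norm h * (g x / K x)" using le by (intro mult_left_mono) auto
        finally show "norm (inner h (grad \<phi> (z - x))) \<le> g x / K x * norm h" by (simp add: mult.commute)
      qed
    qed (use y in \<open>auto simp: dist_norm norm_minus_commute\<close>)
    then show ?thesis using K_pos[of x] by (simp add: field_simps)
  qed
  with g(1) show ?thesis using that by blast
qed

text \<open>The weight \<open>b\<close> is general because it is later taken to be \<open>a\<close>,
  the logarithm of the density, and the constant 1.\<close>

lemma integrable_convolution:
  assumes [measurable]: "b \<in> borel_measurable borel" and b: "\<And>x. \<bar>b x\<bar> \<le> C * K x"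
  shows "integrable lborel (\<lambda>x. b x * \<phi> (y - x))"
    and "integrable lborel (\<lambda>x. b x *\<^sub>R grad \<phi> (y - x))"
proof -
  obtain g where g: "integrable lborel g" "\<And>x. \<phi> (y - x) * K x \<le> g x"
    "\<And>x. norm (grad \<phi> (y - x)) * K x \<le> g x"
    using dominator[of "norm y"] by (metis order_refl)
  have C: "0 \<le> C" using b[of 0] K_pos[of 0] by (smt (verit) mult_neg_pos abs_ge_zero)
  have b_le: "\<bar>b x\<bar> * t \<le> C * g x" if "0 \<le> t" "t * K x \<le> g x" for t x
    using mult_right_mono[OF b \<open>0 \<le> t\<close>, of x] mult_left_mono[OF that(2) C] by (simp add: ac_simps)
  have int: "integrable lborel (\<lambda>x. C * g x)" using g(1) by simp
  show "integrable lborel (\<lambda>x. b x * \<phi> (y - x))"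
  proof (rule Bochner_Integration.integrable_bound[OF int])
    show "(\<lambda>x. b x * \<phi> (y - x)) \<in> borel_measurable lborel" by measurable
    show "AE x in lborel. norm (b x * \<phi> (y - x)) \<le> norm (C * g x)"
    proof (intro AE_I2)
      fix x
      show "norm (b x * \<phi> (y - x)) \<le> norm (C * g x)"
        using b_le[OF \<phi>_nonneg g(2)[of x]] \<phi>_nonneg by (simp add: abs_mult[of "b x"])
    qed
  qed
  show "integrable lborel (\<lambda>x. b x *\<^sub>R grad \<phi> (y - x))"
  proof (rule Bochner_Integration.integrable_bound[OF int])
    show "(\<lambda>x. b x *\<^sub>R grad \<phi> (y - x)) \<in> borel_measurable lborel" by measurable
    show "AE x in lborel. norm (b x *\<^sub>R grad \<phi> (y - x)) \<le> norm (C * g x)"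
    proof (intro AE_I2)
      fix x
      show "norm (b x *\<^sub>R grad \<phi> (y - x)) \<le> norm (C * g x)"
        using b_le[OF norm_ge_zero g(3)[of x]] by simp
    qed
  qed
qed

lemma GDERIV_convolution:
  assumes [measurable]: "b \<in> borel_measurable borel" and b: "\<And>x. \<bar>b x\<bar> \<le> C * K x"
  shows "GDERIV (\<lambda>y. LINT x|lborel. b x * \<phi> (y - x)) y0 :> (LINT x|lborel. b x *\<^sub>R grad \<phi> (y0 - x))"
proof -
  obtain g where g: "integrable lborel g"
    "\<And>x y. norm (y - y0) \<le> 1 \<Longrightarrow> \<bar>\<phi> (y - x) - \<phi> (y0 - x)\<bar> * K x \<le> norm (y - y0) * g x"
    using \<phi>_local_lipschitz[of y0] by metis
  have C: "0 \<le> C" using b[of 0] K_pos[of 0] by (smt (verit) mult_neg_pos abs_ge_zero)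
  show ?thesis
  proof (rule GDERIV_integral[where r = 1 and g = "\<lambda>x. C * g x"])
    fix x
    from has_derivative_mult_right[OF has_derivative_grad_shift[OF \<phi>_diff], of "b x" x y0]
    show "GDERIV (\<lambda>y. b x * \<phi> (y - x)) y0 :> b x *\<^sub>R grad \<phi> (y0 - x)"
      unfolding gderiv_def by simp
    fix y assume y: "norm (y - y0) \<le> 1"
    have "\<bar>b x * \<phi> (y - x) - b x * \<phi> (y0 - x)\<bar> = \<bar>b x\<bar> * \<bar>\<phi> (y - x) - \<phi> (y0 - x)\<bar>"
      by (simp add: abs_mult[symmetric] right_diff_distrib)
    also have "\<dots> \<le> C * K x * \<bar>\<phi> (y - x) - \<phi> (y0 - x)\<bar>" using b by (intro mult_right_mono) auto
    also have "\<dots> \<le> C * (norm (y - y0) * g x)"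
      using mult_left_mono[OF g(2)[OF y] C] by (simp add: ac_simps)
    finally show "\<bar>b x * \<phi> (y - x) - b x * \<phi> (y0 - x)\<bar> \<le> norm (y - y0) * (C * g x)"
      by (simp add: ac_simps)
  qed (use integrable_convolution[OF assms] g(1) in auto)
qed

lemma integrable_grad: "integrable lborel (\<lambda>x. a x *\<^sub>R grad \<phi> (y - x))"
  using a_le integrable_convolution(2)[OF meas(1)] by blast

lemma \<rho>_measurable [measurable]: "\<rho> \<in> borel_measurable borel"
  unfolding \<rho>_eq by measurable

text \<open>With \<open>t = - \<rho> y\<close> and \<open>H 0 = 0\<close>, the bound
  \<open>H_lip\<close> controls \<open>H (\<rho> y)\<close> by a multiple of
  \<open>\<bar>\<rho> y\<bar> * K y\<close>. This is dominated because \<rho> is a finite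
  combination of translates of \<phi>.\<close>

lemma H_int: "integrable lborel (\<lambda>y. H (\<rho> y))"
proof -
  \<comment> \<open>The sum of the norms is a radius that reaches every atom.\<close>
  obtain g where g: "integrable lborel g"
    "\<And>y z. norm z \<le> (\<Sum>q=1..N. norm (x q)) \<Longrightarrow> \<phi> (z - y) * K y \<le> g y"
    using dominator[of "\<Sum>q=1..N. norm (x q)"] by metis
  have \<rho>_K: "\<bar>\<rho> y\<bar> * K y \<le> (\<Sum>q=1..N. \<bar>w q\<bar> * \<bar>g y\<bar>)" for y
  proof -
    have "\<bar>\<rho> y\<bar> * K y \<le> (\<Sum>q=1..N. \<bar>w q * \<phi> (y - x q)\<bar>) * K y"
      using K_pos[of y] unfolding \<rho>_eq by (intro mult_right_mono sum_abs) auto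
    also have "\<dots> = (\<Sum>q=1..N. \<bar>w q\<bar> * (\<phi> (y - x q) * K y))"
      by (simp add: sum_distrib_right abs_mult \<phi>_nonneg mult.assoc)
    also have "\<dots> \<le> (\<Sum>q=1..N. \<bar>w q\<bar> * \<bar>g y\<bar>)"
    proof (intro sum_mono mult_left_mono)
      fix q assume "q \<in> {1..N}"
      then have "norm (x q) \<le> (\<Sum>q=1..N. norm (x q))"
        by (intro member_le_sum) auto
      from g(2)[OF this, of y] show "\<phi> (y - x q) * K y \<le> \<bar>g y\<bar>" by (simp add: \<phi>_sym)
    qed simp
    finally show ?thesis .
  qed
  obtain B where B: "\<And>x. \<phi> x \<le> B" using mollifier_bounded[OF mollifier] by blast
  have \<rho>_le: "\<bar>\<rho> y\<bar> \<le> (\<Sum>q=1..N. \<bar>w q\<bar> * B)" for y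
  proof -
    have "\<bar>\<rho> y\<bar> \<le> (\<Sum>q=1..N. \<bar>w q * \<phi> (y - x q)\<bar>)" unfolding \<rho>_eq by (rule sum_abs)
    also have "\<dots> \<le> (\<Sum>q=1..N. \<bar>w q\<bar> * B)"
      using B \<phi>_nonneg by (intro sum_mono) (simp add: abs_mult mult_left_mono)
    finally show ?thesis .
  qed
  obtain C where C: "\<And>y t. \<bar>t\<bar> \<le> (\<Sum>q=1..N. \<bar>w q\<bar> * B) \<Longrightarrow>
      \<bar>H (\<rho> y + t) - H (\<rho> y)\<bar> \<le> C * \<bar>t\<bar> * K y"
    using H_lip by blast
  have "integrable lborel (\<lambda>y. \<bar>C\<bar> * (\<Sum>q=1..N. \<bar>w q\<bar> * \<bar>g y\<bar>))" using g(1) by simp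
  then show ?thesis
  proof (rule Bochner_Integration.integrable_bound)
    show "(\<lambda>y. H (\<rho> y)) \<in> borel_measurable lborel" by measurable
    show "AE y in lborel. norm (H (\<rho> y)) \<le> norm (\<bar>C\<bar> * (\<Sum>q=1..N. \<bar>w q\<bar> * \<bar>g y\<bar>))"
    proof (intro AE_I2)
      fix y
      have "\<bar>H (\<rho> y)\<bar> \<le> C * (\<bar>\<rho> y\<bar> * K y)"
        using C[of "- \<rho> y" y] \<rho>_le[of y] by (simp add: H_0 mult.assoc)
      also have "\<dots> \<le> \<bar>C\<bar> * (\<bar>\<rho> y\<bar> * K y)"
        using K_pos[of y] by (intro mult_right_mono) auto
      also have "\<dots> \<le> \<bar>C\<bar> * (\<Sum>q=1..N. \<bar>w q\<bar> * \<bar>g y\<bar>)"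
        using \<rho>_K by (intro mult_left_mono) auto
      finally show "norm (H (\<rho> y)) \<le> norm (\<bar>C\<bar> * (\<Sum>q=1..N. \<bar>w q\<bar> * \<bar>g y\<bar>))" by simp
    qed
  qed
qed

text \<open>As \<phi> takes values between 0 and \<open>B\<close>, the density changes by at most
  \<open>\<bar>c\<bar> * B\<close>, so one constant from \<open>H_lip\<close> serves for all
  positions. The local Lipschitz bound on \<phi> then supplies the dominating function.\<close>

lemma GDERIV_moving_particle:
  "GDERIV (\<lambda>y. LINT x|lborel. H (\<rho> x + c * (\<phi> (y - x) - \<phi> (y0 - x)))) y0 :>
    c *\<^sub>R (LINT x|lborel. a x *\<^sub>R grad \<phi> (y0 - x))"
proof -
  obtain g where g: "integrable lborel g"
    "\<And>x y. norm (y - y0) \<le> 1 \<Longrightarrow> \<bar>\<phi> (y - x) - \<phi> (y0 - x)\<bar> * K x \<le> norm (y - y0) * g x"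
    using \<phi>_local_lipschitz[of y0] by metis
  obtain B where B: "\<And>x. \<phi> x \<le> B" using mollifier_bounded[OF mollifier] by blast
  have t_le: "\<bar>c * (\<phi> (y - x) - \<phi> (y0 - x))\<bar> \<le> \<bar>c\<bar> * B" for x y
    using B[of "y - x"] B[of "y0 - x"] \<phi>_nonneg[of "y - x"] \<phi>_nonneg[of "y0 - x"]
    by (auto simp: abs_mult abs_le_iff intro!: mult_left_mono)
  obtain C where C: "\<And>x t. \<bar>t\<bar> \<le> \<bar>c\<bar> * B \<Longrightarrow> \<bar>H (\<rho> x + t) - H (\<rho> x)\<bar> \<le> C * \<bar>t\<bar> * K x"
    using H_lip by blast
  have "GDERIV (\<lambda>y. LINT x|lborel. H (\<rho> x + c * (\<phi> (y - x) - \<phi> (y0 - x)))) y0 :>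
      (LINT x|lborel. c *\<^sub>R (a x *\<^sub>R grad \<phi> (y0 - x)))"
  proof (rule GDERIV_integral[where r = 1 and g = "\<lambda>x. \<bar>C\<bar> * \<bar>c\<bar> * g x"])
    fix x
    from has_derivative_grad_shift[OF \<phi>_diff, of x y0] have "GDERIV (\<lambda>y. \<rho> x + c * (\<phi> (y - x) - \<phi> (y0 - x))) y0 :> c *\<^sub>R grad \<phi> (y0 - x)"
      unfolding gderiv_def by (auto intro!: derivative_eq_intros)
    from GDERIV_DERIV_compose[OF this, of H "a x"] H_deriv[of x]
    show "GDERIV (\<lambda>y. H (\<rho> x + c * (\<phi> (y - x) - \<phi> (y0 - x)))) y0 :> c *\<^sub>R (a x *\<^sub>R grad \<phi> (y0 - x))"
      by (simp add: mult.commute)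
    fix y assume y: "norm (y - y0) \<le> 1"
    let ?t = "c * (\<phi> (y - x) - \<phi> (y0 - x))"
    have "\<bar>H (\<rho> x + ?t) - H (\<rho> x)\<bar> \<le> C * (\<bar>?t\<bar> * K x)"
      using C[OF t_le] by (simp add: mult.assoc)
    also have "\<dots> \<le> \<bar>C\<bar> * (\<bar>?t\<bar> * K x)"
      using K_pos[of x] by (intro mult_right_mono) auto
    also have "\<dots> \<le> \<bar>C\<bar> * (\<bar>c\<bar> * (norm (y - y0) * g x))"
      using mult_left_mono[OF g(2)[OF y], of "\<bar>c\<bar>" x]
      by (intro mult_left_mono) (simp_all add: abs_mult mult.assoc)
    finally show "\<bar>H (\<rho> x + ?t) - H (\<rho> x + c * (\<phi> (y0 - x) - \<phi> (y0 - x)))\<bar>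
        \<le> norm (y - y0) * (\<bar>C\<bar> * \<bar>c\<bar> * g x)"
      by (simp add: ac_simps)
  next
    show "integrable lborel (\<lambda>x. c *\<^sub>R (a x *\<^sub>R grad \<phi> (y0 - x)))"
      by (intro integrable_scaleR_right integrable_grad)
  qed (use H_int g(1) in auto)
  then show ?thesis by (simp only: integral_scaleR_right)
qed

text \<open>The density moves in the direction \<open>u\<close>, the convolution of \<eta> with
  \<phi>. Since \<open>u\<close> is bounded and \<open>\<bar>u\<bar> * K\<close> is dominated,
  differentiation under the integral pairs \<open>a\<close> with \<open>u\<close>; Fubini moves the
  convolution from \<eta> onto \<open>a\<close>.\<close>

lemma DERIV_perturbed_density:
  assumes \<eta>: "continuous_on UNIV \<eta>" "compact (closure {x. \<eta> x \<noteq> 0})"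
  shows "((\<lambda>\<alpha>. LINT x|lborel. H (\<rho> x + \<alpha> * (LINT y|lborel. \<eta> y * \<phi> (x - y)))) has_real_derivative
    (LINT y|lborel. \<eta> y * (LINT x|lborel. a x * \<phi> (y - x)))) (at 0)"
proof -
  have [measurable]: "\<eta> \<in> borel_measurable borel"
    using \<eta>(1) by (rule borel_measurable_continuous_onI)
  have supp: "\<eta> y = 0" if "y \<notin> closure {x. \<eta> x \<noteq> 0}" for y
    using that closure_subset[of "{x. \<eta> x \<noteq> 0}"] by auto
  have int_\<eta>: "integrable lborel (\<lambda>y. \<eta> y * D y)" if "continuous_on UNIV D" for D
    using continuous_on_mult[OF \<eta>(1) that]
    by (rule integrable_compact_support[OF _ \<eta>(2)]) (metis supp mult_zero_left)
  have \<phi>_shift: "continuous_on UNIV (\<lambda>y. \<phi> (x - y))" for x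
    by (rule continuous_on_compose2[OF mollifier_continuous[OF mollifier(2)]]) (simp_all add: continuous_on_diff continuous_on_id)
  from compact_imp_bounded[OF \<eta>(2)] obtain R where "\<And>y. y \<in> closure {x. \<eta> x \<noteq> 0} \<Longrightarrow> norm y \<le> R"
    unfolding bounded_iff by blast
  then have R: "norm y \<le> R" if "\<eta> y \<noteq> 0" for y using supp that by metis
  obtain g where g: "integrable lborel g" "\<And>x y. norm y \<le> R \<Longrightarrow> \<phi> (y - x) * K x \<le> g x"
    using dominator[of R] by metis
  \<comment> \<open>Where \<eta> is nonzero the translation has length at most \<open>R\<close>, so
    one majorant serves; where \<eta> vanishes both sides are 0.\<close>
  have \<eta>_le: "\<bar>\<eta> y\<bar> * (\<phi> (x - y) * K x) \<le> \<bar>\<eta> y\<bar> * \<bar>g x\<bar>" for x y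
  proof (cases "\<eta> y = 0")
    case False
    then show ?thesis using g(2)[OF R, of y x] by (intro mult_left_mono) (auto simp: \<phi>_sym)
  qed simp
  define u where "u x = (LINT y|lborel. \<eta> y * \<phi> (x - y))" for x
  have u_meas [measurable]: "u \<in> borel_measurable borel"
    unfolding u_def by measurable
  define I where "I = (LINT y|lborel. \<bar>\<eta> y\<bar>)"
  have abs_\<eta>: "integrable lborel (\<lambda>y. \<bar>\<eta> y\<bar>)" using int_\<eta>[of "\<lambda>_. 1"] by simp
  have I0: "0 \<le> I" unfolding I_def by simp
  have u_int: "\<bar>u x\<bar> \<le> (LINT y|lborel. \<bar>\<eta> y\<bar> * \<phi> (x - y))" for x
    unfolding u_def using integral_abs_bound[of lborel "\<lambda>y. \<eta> y * \<phi> (x - y)"]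
    by (simp add: abs_mult \<phi>_nonneg)
  have int_abs: "integrable lborel (\<lambda>y. \<bar>\<eta> y\<bar> * \<phi> (x - y))" for x
    using integrable_abs[OF int_\<eta>[OF \<phi>_shift[of x]]] by (simp add: abs_mult \<phi>_nonneg)
  have u_K: "\<bar>u x\<bar> * K x \<le> I * \<bar>g x\<bar>" for x
  proof -
    have "\<bar>u x\<bar> * K x \<le> (LINT y|lborel. \<bar>\<eta> y\<bar> * \<phi> (x - y)) * K x"
      using u_int K_pos[of x] by (intro mult_right_mono) auto
    also have "\<dots> = (LINT y|lborel. \<bar>\<eta> y\<bar> * (\<phi> (x - y) * K x))"
      by (simp add: mult.assoc[symmetric])
    also have "\<dots> \<le> (LINT y|lborel. \<bar>\<eta> y\<bar> * \<bar>g x\<bar>)"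
      using \<eta>_le int_abs abs_\<eta> by (intro integral_mono) (auto simp: mult.assoc[symmetric])
    finally show ?thesis by (simp add: I_def)
  qed
  obtain B where B: "\<And>x. \<phi> x \<le> B" using mollifier_bounded[OF mollifier] by blast
  have u_B: "\<bar>u x\<bar> \<le> I * B" for x
  proof -
    have "(LINT y|lborel. \<bar>\<eta> y\<bar> * \<phi> (x - y)) \<le> (LINT y|lborel. \<bar>\<eta> y\<bar> * B)"
      using B int_abs abs_\<eta> by (intro integral_mono) (auto intro: mult_left_mono)
    with u_int[of x] show ?thesis by (simp add: I_def)
  qed
  obtain C where C: "\<And>x t. \<bar>t\<bar> \<le> I * B \<Longrightarrow> \<bar>H (\<rho> x + t) - H (\<rho> x)\<bar> \<le> C * \<bar>t\<bar> * K x"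
    using H_lip by blast
  obtain A where A: "\<And>x. \<bar>a x\<bar> \<le> A * K x" using a_le by blast
  have A0: "0 \<le> A" using A[of 0] K_pos[of 0] by (smt (verit) mult_neg_pos abs_ge_zero)
  have au: "\<bar>a x\<bar> * \<bar>u x\<bar> \<le> A * (I * \<bar>g x\<bar>)" for x
  proof -
    have "\<bar>a x\<bar> * \<bar>u x\<bar> \<le> A * K x * \<bar>u x\<bar>" using A by (intro mult_right_mono) auto
    also have "\<dots> \<le> A * (I * \<bar>g x\<bar>)"
      using mult_left_mono[OF u_K A0, of x] by (simp add: ac_simps)
    finally show ?thesis .
  qed
  \<comment> \<open>On the reals the gradient is the ordinary derivative. The radius 1 for \<alpha>
    keeps \<open>\<alpha> * u x\<close> within \<open>I * B\<close>, where the constant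
    \<open>C\<close> is valid.\<close>
  have "GDERIV (\<lambda>\<alpha>. LINT x|lborel. H (\<rho> x + \<alpha> * u x)) 0 :> (LINT x|lborel. a x * u x)"
  proof (rule GDERIV_integral[where r = 1 and g = "\<lambda>x. \<bar>C\<bar> * (I * \<bar>g x\<bar>)"])
    have "integrable lborel (\<lambda>x. A * (I * \<bar>g x\<bar>))" using g(1) by simp
    then show "integrable lborel (\<lambda>x. a x * u x)"
      by (rule Bochner_Integration.integrable_bound)
        (measurable, intro AE_I2, use au I0 A0 in \<open>simp add: abs_mult\<close>)
    fix x
    show "GDERIV (\<lambda>\<alpha>. H (\<rho> x + \<alpha> * u x)) 0 :> a x * u x"
      using H_deriv[of x] unfolding gderiv_deriv
      by (intro DERIV_chain2[where g = "\<lambda>\<alpha>. \<rho> x + \<alpha> * u x"]) (auto intro!: derivative_eq_intros)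
    fix \<alpha> :: real assume "norm (\<alpha> - 0) \<le> 1"
    then have "\<bar>\<alpha> * u x\<bar> \<le> I * B"
      using mult_mono[OF _ u_B[of x], of "\<bar>\<alpha>\<bar>" 1] by (simp add: abs_mult)
    from C[OF this, of x] have "\<bar>H (\<rho> x + \<alpha> * u x) - H (\<rho> x)\<bar> \<le> C * (\<bar>\<alpha>\<bar> * \<bar>u x\<bar> * K x)"
      by (simp add: abs_mult mult.assoc)
    also have "\<dots> \<le> \<bar>C\<bar> * (\<bar>\<alpha>\<bar> * \<bar>u x\<bar> * K x)"
      using K_pos[of x] by (intro mult_right_mono) auto
    also have "\<dots> \<le> \<bar>C\<bar> * (\<bar>\<alpha>\<bar> * (I * \<bar>g x\<bar>))"
      using mult_left_mono[OF u_K[of x], of "\<bar>\<alpha>\<bar>"]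
      by (intro mult_left_mono) (simp_all add: mult.assoc)
    finally show "\<bar>H (\<rho> x + \<alpha> * u x) - H (\<rho> x + 0 * u x)\<bar> \<le> norm (\<alpha> - 0) * (\<bar>C\<bar> * (I * \<bar>g x\<bar>))"
      by (simp add: ac_simps)
  qed (use H_int g(1) in auto)
  moreover have "(LINT x|lborel. a x * u x) = (LINT y|lborel. \<eta> y * (LINT x|lborel. a x * \<phi> (y - x)))"
  proof -
    have le: "\<bar>\<eta> y * (a x * \<phi> (y - x))\<bar> \<le> \<bar>\<eta> y\<bar> * (A * \<bar>g x\<bar>)" for x y
    proof -
      have "\<bar>\<eta> y * (a x * \<phi> (y - x))\<bar> = \<bar>a x\<bar> * (\<bar>\<eta> y\<bar> * \<phi> (x - y))"
        by (simp add: abs_mult \<phi>_nonneg \<phi>_sym)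
      also have "\<dots> \<le> A * K x * (\<bar>\<eta> y\<bar> * \<phi> (x - y))"
        using A \<phi>_nonneg by (intro mult_right_mono) auto
      also have "\<dots> \<le> A * (\<bar>\<eta> y\<bar> * \<bar>g x\<bar>)"
        using mult_left_mono[OF \<eta>_le A0, of y x] by (simp add: ac_simps)
      finally show ?thesis by (simp add: ac_simps)
    qed
    have [measurable]: "g \<in> borel_measurable borel" using g(1) by simp
    \<comment> \<open>A product of integrable functions of separate variables majorizes the double
      integrand, as Fubini requires.\<close>
    have "integrable (lborel \<Otimes>\<^sub>M lborel) (\<lambda>(y, x). \<bar>\<eta> y\<bar> * (A * \<bar>g x\<bar>))"
      using g(1) abs_\<eta> by (intro lborel_pair.Fubini_integrable) (auto simp: abs_mult)
    then have "integrable (lborel \<Otimes>\<^sub>M lborel) (\<lambda>(y, x). \<eta> y * (a x * \<phi> (y - x)))"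
      by (rule Bochner_Integration.integrable_bound)
        (measurable, intro AE_I2, use le A0 in \<open>auto simp: abs_mult split: prod.split\<close>)
    from lborel_pair.Fubini_integral[OF this]
    have "(LINT x|lborel. LINT y|lborel. \<eta> y * (a x * \<phi> (y - x))) =
        (LINT y|lborel. \<eta> y * (LINT x|lborel. a x * \<phi> (y - x)))" by simp
    then show ?thesis
      unfolding u_def by (simp add: mult.left_commute \<phi>_sym integral_mult_right_zero[symmetric]
          del: integral_mult_right_zero)
  qed
  ultimately show ?thesis by (simp add: u_def)
qed

lemma is_variational_derivative_entropy:
  shows "is_variational_derivative (\<lambda>f. LINT y|lborel. H (convol f \<phi> y)) (atomic N w x)
    (\<lambda>z. LINT y|lborel. a y * \<phi> (z - y))"
  unfolding is_variational_derivative_def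
proof (intro conjI allI impI)
  from a_le obtain C where "\<And>x. \<bar>a x\<bar> \<le> C * K x" by blast
  then show "continuous_on UNIV (\<lambda>z. LINT y|lborel. a y * \<phi> (z - y))"
    using GDERIV_convolution[OF meas(1)] GDERIV_differentiable
    by (meson continuous_at_imp_continuous_on differentiable_imp_continuous_within)
  fix \<eta> :: "'a \<Rightarrow> real"
  assume "continuous_on UNIV \<eta> \<and> compact (closure {x. \<eta> x \<noteq> 0})"
  then show "((\<lambda>\<alpha>. LINT y|lborel. H (convol (perturb (atomic N w x) \<alpha> \<eta>) \<phi> y)) has_real_derivative
      (LINT z|lborel. \<eta> z * (LINT y|lborel. a y * \<phi> (z - y)))) (at 0)"
    using DERIV_perturbed_density[of \<eta>] by (simp add: convol_def perturb_def atomic_def \<rho>_eq)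
qed

lemma GDERIV_entropy:
  assumes "p \<in> {1..N}"
  shows "GDERIV (\<lambda>z. LINT y|lborel. H (convol (atomic N w (x(p := z))) \<phi> y)) (x p) :>
    w p *\<^sub>R (LINT y|lborel. a y *\<^sub>R grad \<phi> (x p - y))"
proof -
  have "convol (atomic N w (x(p := z))) \<phi> y = \<rho> y + w p * (\<phi> (z - y) - \<phi> (x p - y))" for z y
  proof -
    have "convol (atomic N w (x(p := z))) \<phi> y - \<rho> y =
        (\<Sum>q=1..N. if q = p then w p * (\<phi> (z - y) - \<phi> (x p - y)) else 0)"
      unfolding convol_def atomic_def \<rho>_eq sum_subtractf[symmetric]
      by (intro sum.cong refl) (simp add: right_diff_distrib \<phi>_sym)
    then show ?thesis using assms by simp
  qed
  then show ?thesis using GDERIV_moving_particle by simp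
qed

lemma GDERIV_entropy_variation:
  "GDERIV (\<lambda>z. LINT y|lborel. a y * \<phi> (z - y)) z0 :> (LINT y|lborel. a y *\<^sub>R grad \<phi> (z0 - y))"
  using a_le GDERIV_convolution[OF meas(1)] by blast

text \<open>The integral of \<open>\<phi> (z - y)\<close> over \<open>y\<close> does not depend on
  \<open>z\<close>, so its gradient, taken under the integral, is zero.\<close>

lemma integral_grad_eq_0: "(LINT y|lborel. grad \<phi> (z - y)) = 0"
proof -
  have "GDERIV (\<lambda>z. LINT y|lborel. 1 * \<phi> (z - y)) z :> (LINT y|lborel. 1 *\<^sub>R grad \<phi> (z - y))"
    by (rule GDERIV_convolution[where C = 1]) (use K_ge_1 in simp_all)
  then have "GDERIV (\<lambda>_. LINT y|lborel. \<phi> y) z :> (LINT y|lborel. grad \<phi> (z - y))"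
    by (simp add: integral_reflect_translate)
  then show ?thesis by (rule GDERIV_unique) (rule GDERIV_const)
qed

end

section \<open>Increment bounds for the two entropy densities\<close>

lemma H_log_increment:
  assumes "0 < s" "\<bar>t\<bar> \<le> M"
  shows "\<bar>H_log (s + t) - H_log s\<bar> \<le> (9 * M + 5) * \<bar>t\<bar> * (1 + \<bar>ln s\<bar>)"
proof (cases "\<bar>t\<bar> \<le> s / 2")
  \<comment> \<open>Small increment: the segment stays in \<open>{s / 2 .. 3 * s / 2}\<close>, where
    the logarithm differs from \<open>ln s\<close> by at most 1, and the mean value inequality
    applies.\<close>
  case True
  have deriv: "DERIV H_log \<xi> :> ln \<xi> + 1" if "0 < \<xi>" for \<xi>
    unfolding H_log_def using that by (auto intro!: derivative_eq_intros)
  have "norm (H_log (s + t) - H_log s) \<le> (2 + \<bar>ln s\<bar>) * norm (s + t - s)"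
  proof (rule field_differentiable_bound[where S = "{s / 2 .. 3 * s / 2}" and f' = "\<lambda>\<xi>. ln \<xi> + 1"])
    fix \<xi> assume \<xi>: "\<xi> \<in> {s / 2 .. 3 * s / 2}"
    then have pos: "0 < \<xi>" using assms(1) by auto
    have "ln (\<xi> / s) \<le> \<xi> / s - 1" using pos assms(1) by (intro ln_le_minus_one) simp
    moreover have "ln (s / \<xi>) \<le> s / \<xi> - 1" using pos assms(1) by (intro ln_le_minus_one) simp
    moreover have "\<xi> / s \<le> 2" "s / \<xi> \<le> 2" using \<xi> pos assms(1) by (simp_all add: pos_divide_le_eq)
    ultimately have "\<bar>ln \<xi> - ln s\<bar> \<le> 1" using pos assms(1) by (simp add: ln_div)
    then show "norm (ln \<xi> + 1) \<le> 2 + \<bar>ln s\<bar>" by simp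
  next
    fix \<xi> assume "\<xi> \<in> {s / 2 .. 3 * s / 2}"
    then show "(H_log has_field_derivative ln \<xi> + 1) (at \<xi> within {s / 2 .. 3 * s / 2})"
      using assms(1) by (auto intro: has_field_derivative_at_within[OF deriv])
  qed (use True assms(1) in auto)
  also have "\<dots> \<le> ((9 * M + 5) * (1 + \<bar>ln s\<bar>)) * \<bar>t\<bar>"
  proof -
    have "0 \<le> M" using assms(2) by linarith
    then have "5 * (1 + \<bar>ln s\<bar>) \<le> (9 * M + 5) * (1 + \<bar>ln s\<bar>)" by (intro mult_right_mono) auto
    then show ?thesis by (simp add: mult_right_mono)
  qed
  finally show ?thesis by (simp add: ac_simps)
next
  \<comment> \<open>Large increment: now \<open>s \<le> 2 * \<bar>t\<bar>\<close>, so the two values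
    are estimated separately.\<close>
  case False
  then have s: "s \<le> 2 * \<bar>t\<bar>" by simp
  define r where "r = \<bar>s + t\<bar>"
  have r: "0 \<le> r" "r \<le> 3 * \<bar>t\<bar>" using s assms(1) by (auto simp: r_def)
  \<comment> \<open>Since \<open>ln\<close> is even on the reals, negative values of
    \<open>s + t\<close> are covered through their absolute value.\<close>
  have abs_H: "\<bar>H_log (s + t)\<bar> = r * \<bar>ln r\<bar>"
    using ln_minus[of "s + t"] by (cases "s + t \<ge> 0") (auto simp: H_log_def r_def abs_mult)
  have "\<bar>H_log s\<bar> \<le> 2 * \<bar>t\<bar> * \<bar>ln s\<bar>"
    using s assms(1) by (auto simp: H_log_def abs_mult intro: mult_right_mono)
  moreover have "r * \<bar>ln r\<bar> \<le> 3 * \<bar>t\<bar> * (\<bar>ln s\<bar> + 3 * M) + 2 * \<bar>t\<bar>"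
  proof -
    consider "r = 0" | "0 < r" "r < s" | "s \<le> r" using r by linarith
    then show ?thesis
    proof cases
      case 1
      then show ?thesis using assms(2) by simp
    next
      case 2
      \<comment> \<open>Here \<open>ln r\<close> may lie far below \<open>ln s\<close>, but the
        excess is \<open>ln (s / r)\<close>, and
        \<open>r * ln (s / r) \<le> s \<le> 2 * \<bar>t\<bar>\<close>.\<close>
      have "r * \<bar>ln r\<bar> \<le> r * \<bar>ln s\<bar> + r * ln (s / r)"
      proof -
        have "ln r \<le> ln s" using 2 by simp
        moreover have "ln (s / r) = ln s - ln r" using 2 assms(1) by (simp add: ln_div)
        ultimately have "\<bar>ln r\<bar> \<le> \<bar>ln s\<bar> + ln (s / r)" by linarith
        then show ?thesis using r(1) by (simp add: distrib_left[symmetric] mult_left_mono)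
      qed
      moreover have "r * ln (s / r) \<le> s"
      proof -
        have "ln (s / r) \<le> s / r" using 2 assms(1) ln_le_minus_one[of "s / r"] by simp
        then have "r * ln (s / r) \<le> r * (s / r)" using r(1) by (rule mult_left_mono)
        then show ?thesis using 2 by simp
      qed
      moreover have "r * \<bar>ln s\<bar> \<le> 3 * \<bar>t\<bar> * \<bar>ln s\<bar>" using r(2) by (intro mult_right_mono) auto
      moreover have "0 \<le> \<bar>t\<bar> * M" using assms(2) by auto
      ultimately show ?thesis using s by (simp add: distrib_left)
    next
      \<comment> \<open>Here \<open>ln r\<close> lies between \<open>ln s\<close> and
        \<open>r\<close>, and \<open>r \<le> 3 * M\<close>.\<close>
      case 3
      then have "ln s \<le> ln r" "ln r \<le> r" using assms(1) ln_le_minus_one[of r] by auto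
      then have "\<bar>ln r\<bar> \<le> \<bar>ln s\<bar> + 3 * M" using r assms(2) by linarith
      then have "r * \<bar>ln r\<bar> \<le> 3 * \<bar>t\<bar> * (\<bar>ln s\<bar> + 3 * M)"
        using r by (intro mult_mono) auto
      then show ?thesis by simp
    qed
  qed
  \<comment> \<open>The coefficient 5 is 2 from \<open>H_log s\<close> plus 3 from
    \<open>H_log (s + t)\<close>; the latter also contributes \<open>3 * 3 * M\<close> and
    2.\<close>
  ultimately have "\<bar>H_log (s + t) - H_log s\<bar> \<le> \<bar>t\<bar> * (5 * \<bar>ln s\<bar> + 9 * M + 2)"
    using abs_H abs_triangle_ineq4[of "H_log (s + t)" "H_log s"] by (simp add: algebra_simps)
  also have "\<dots> \<le> \<bar>t\<bar> * ((9 * M + 5) * (1 + \<bar>ln s\<bar>))"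
  proof (intro mult_left_mono)
    have "0 \<le> M * \<bar>ln s\<bar>" using assms(2) by auto
    then show "5 * \<bar>ln s\<bar> + 9 * M + 2 \<le> (9 * M + 5) * (1 + \<bar>ln s\<bar>)" by (simp add: algebra_simps)
  qed simp
  finally show ?thesis by (simp add: ac_simps)
qed

text \<open>At 0 the difference quotient has absolute value
  \<open>\<bar>h\<bar> powr (m - 1)\<close> on both sides, because real \<open>powr\<close> depends
  only on the absolute value of its base. It tends to 0 as \<open>m > 1\<close>.\<close>

lemma DERIV_powr_nonneg:
  fixes m s :: real
  assumes "m > 1" "0 \<le> s"
  shows "DERIV (\<lambda>s. s powr m) s :> m * s powr (m - 1)"
proof (cases "s = 0")
  case True
  have "((\<lambda>h. \<bar>h\<bar> powr (m - 1)) \<longlongrightarrow> 0) (at (0::real))"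
    using assms(1) by (intro tendsto_zero_powrI[where b = "m - 1"] tendsto_rabs_zero tendsto_ident_at) auto
  moreover have "\<bar>h powr m / h\<bar> = \<bar>h\<bar> powr (m - 1)" if "h \<noteq> 0" for h :: real
  proof -
    have "h powr m = \<bar>h\<bar> powr m" using ln_minus[of h] by (simp add: powr_def abs_if)
    then show ?thesis using that by (simp add: powr_diff)
  qed
  ultimately have "((\<lambda>h. \<bar>h powr m / h\<bar>) \<longlongrightarrow> 0) (at 0)"
    by (subst tendsto_cong) (auto simp: eventually_at_filter)
  then have "((\<lambda>h. h powr m / h) \<longlongrightarrow> 0) (at 0)" by (rule tendsto_rabs_zero_cancel)
  then show ?thesis using True assms by (simp add: DERIV_def)
next
  case False
  then show ?thesis using assms(2) by (intro has_real_derivative_powr) simp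
qed

text \<open>As \<open>powr\<close> is even in its base, \<open>s + t\<close> can be replaced by its
  absolute value. This lies in \<open>{0..B + M}\<close> and is no farther from \<open>s\<close>
  than \<open>\<bar>t\<bar>\<close>, so the mean value inequality applies on that interval.\<close>

lemma H_pow_increment:
  assumes m: "m > 1" and s: "0 \<le> s" "s \<le> B" and t: "\<bar>t\<bar> \<le> M"
  shows "\<bar>H_pow m (s + t) - H_pow m s\<bar> \<le> m / (m - 1) * (B + M) powr (m - 1) * \<bar>t\<bar>"
proof -
  let ?L = "B + M"
  have "norm (\<bar>s + t\<bar> powr m - s powr m) \<le> (m * ?L powr (m - 1)) * norm (\<bar>s + t\<bar> - s)"
  proof (rule field_differentiable_bound[where S = "{0..?L}" and f' = "\<lambda>\<xi>. m * \<xi> powr (m - 1)"])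
    fix \<xi> assume \<xi>: "\<xi> \<in> {0..?L}"
    show "((\<lambda>s. s powr m) has_field_derivative m * \<xi> powr (m - 1)) (at \<xi> within {0..?L})"
      using \<xi> m by (auto intro: has_field_derivative_at_within[OF DERIV_powr_nonneg])
    show "norm (m * \<xi> powr (m - 1)) \<le> m * ?L powr (m - 1)"
      using \<xi> m powr_mono2[of "m - 1" \<xi> ?L] by (simp add: abs_mult)
  qed (use s t in auto)
  also have "\<dots> \<le> (m * ?L powr (m - 1)) * \<bar>t\<bar>"
    using s m by (intro mult_left_mono) auto
  finally have le: "\<bar>\<bar>s + t\<bar> powr m - s powr m\<bar> \<le> (m * ?L powr (m - 1)) * \<bar>t\<bar>" by simp
  have "(s + t) powr m = \<bar>s + t\<bar> powr m" using ln_minus[of "s + t"] by (simp add: powr_def abs_if)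
  then have "H_pow m (s + t) - H_pow m s = (\<bar>s + t\<bar> powr m - s powr m) / (m - 1)"
    by (simp add: H_pow_def diff_divide_distrib)
  then show ?thesis using divide_right_mono[OF le, of "m - 1"] m by simp
qed

section \<open>The two entropies as instances, and the equality of the gradients\<close>

lemma mollified_density_bounds:
  fixes \<phi> :: "'a::euclidean_space \<Rightarrow> real"
  assumes "symmetric_mollifier \<phi>" "regular_mollifier \<phi>" and w: "\<And>q. q \<in> {1..N} \<Longrightarrow> w q > 0"
  shows "\<exists>B. \<forall>y. 0 \<le> (\<Sum>q=1..N. w q * \<phi> (y - x q)) \<and> (\<Sum>q=1..N. w q * \<phi> (y - x q)) \<le> B"
proof -
  obtain B where B: "\<And>x. \<phi> x \<le> B" using mollifier_bounded[OF assms(1,2)] by blast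
  have nonneg: "0 \<le> \<phi> y" for y using assms(1) by (simp add: symmetric_mollifier_def)
  have "(\<Sum>q=1..N. w q * \<phi> (y - x q)) \<le> (\<Sum>q=1..N. w q * B)" for y
    using B w by (intro sum_mono mult_left_mono) (auto intro: less_imp_le)
  moreover have "0 \<le> (\<Sum>q=1..N. w q * \<phi> (y - x q))" for y
    using nonneg w by (intro sum_nonneg mult_nonneg_nonneg) (auto intro: less_imp_le)
  ultimately show ?thesis by blast
qed

text \<open>The density is bounded, hence so is \<open>H'\<close> along it, and the weight 1
  suffices.\<close>

lemma mollified_entropy_pow:
  fixes \<phi> :: "'a::euclidean_space \<Rightarrow> real" and x :: "nat \<Rightarrow> 'a"
  assumes m: "m > 1" and moll: "symmetric_mollifier \<phi>" "regular_mollifier \<phi>"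
    and w: "\<And>q. q \<in> {1..N} \<Longrightarrow> w q > 0"
  defines "\<rho> \<equiv> \<lambda>y. \<Sum>q=1..N. w q * \<phi> (y - x q)"
  shows "mollified_entropy \<phi> (H_pow m) N w x \<rho> (\<lambda>y. m / (m - 1) * \<rho> y powr (m - 1)) (\<lambda>_. 1)"
proof -
  obtain B where B: "\<And>y. 0 \<le> \<rho> y" "\<And>y. \<rho> y \<le> B"
    using mollified_density_bounds[of \<phi> N w x, OF moll w] unfolding \<rho>_def by blast
  have [measurable]: "\<phi> \<in> borel_measurable borel"
    using mollifier_continuous[OF moll(2)] by (rule borel_measurable_continuous_onI)
  have [measurable]: "\<rho> \<in> borel_measurable borel" unfolding \<rho>_def by measurable
  show ?thesis
  proof
    show "DERIV (H_pow m) (\<rho> y) :> m / (m - 1) * \<rho> y powr (m - 1)" for y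
      unfolding H_pow_def using DERIV_cmult[OF DERIV_powr_nonneg[OF m B(1)], of "1 / (m - 1)"] by simp
    have "\<bar>m / (m - 1) * \<rho> y powr (m - 1)\<bar> \<le> (m / (m - 1) * B powr (m - 1)) * 1" for y
      using m mult_left_mono[OF powr_mono2[OF _ B(1,2)], of "m - 1" "m / (m - 1)" y]
      by (simp add: abs_mult)
    then show "\<exists>C. \<forall>y. \<bar>m / (m - 1) * \<rho> y powr (m - 1)\<bar> \<le> C * 1" by blast
    show "\<exists>C. \<forall>y t. \<bar>t\<bar> \<le> M \<longrightarrow> \<bar>H_pow m (\<rho> y + t) - H_pow m (\<rho> y)\<bar> \<le> C * \<bar>t\<bar> * 1" for M
      using H_pow_increment[OF m B] by (intro exI[of _ "m / (m - 1) * (B + M) powr (m - 1)"]) simp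
    show "\<exists>g. integrable lborel g \<and>
        (\<forall>y z. norm z \<le> R \<longrightarrow> (\<phi> (y + z) + norm (grad \<phi> (y + z))) * 1 \<le> g y)" for R
      using moll(2) unfolding regular_mollifier_def by simp
    show "H_pow m \<in> borel_measurable borel" unfolding H_pow_def by measurable
  qed (use moll in \<open>simp_all add: \<rho>_def H_pow_def\<close>)
qed

text \<open>\<open>log_regular_mollifier\<close> controls logarithms of single translates of \<phi>,
  whereas the density is a weighted sum of them. So \<open>ln \<rho>\<close> is compared with the
  logarithm of the \<open>p\<close>-th summand from below, and bounded above because \<rho>
  is.\<close>

lemma mollified_entropy_log:
  fixes \<phi> :: "'a::euclidean_space \<Rightarrow> real" and x :: "nat \<Rightarrow> 'a"
  assumes moll: "symmetric_mollifier \<phi>" "regular_mollifier \<phi>" "log_regular_mollifier \<phi>"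
    and w: "\<And>q. q \<in> {1..N} \<Longrightarrow> w q > 0" and p: "p \<in> {1..N}"
  defines "\<rho> \<equiv> \<lambda>y. \<Sum>q=1..N. w q * \<phi> (y - x q)"
  shows "mollified_entropy \<phi> H_log N w x \<rho> (\<lambda>y. ln (\<rho> y) + 1) (\<lambda>y. 1 + \<bar>ln (\<rho> y)\<bar>)"
proof -
  obtain B where B: "\<And>y. 0 \<le> \<rho> y" "\<And>y. \<rho> y \<le> B"
    using mollified_density_bounds[of \<phi> N w x, OF moll(1,2) w] unfolding \<rho>_def by blast
  have [measurable]: "\<phi> \<in> borel_measurable borel"
    using mollifier_continuous[OF moll(2)] by (rule borel_measurable_continuous_onI)
  have [measurable]: "\<rho> \<in> borel_measurable borel" unfolding \<rho>_def by measurable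
  have \<phi>_pos: "0 < \<phi> y" for y using moll(3) by (simp add: log_regular_mollifier_def)
  have ge: "w p * \<phi> (y - x p) \<le> \<rho> y" for y
    unfolding \<rho>_def using p w \<phi>_pos
    by (intro member_le_sum[where f = "\<lambda>q. w q * \<phi> (y - x q)"]) (auto intro: less_imp_le)
  have wp: "0 < w p" using w p by blast
  have \<rho>_pos: "0 < \<rho> y" for y using ge[of y] mult_pos_pos[OF wp \<phi>_pos[of "y - x p"]] by linarith
  \<comment> \<open>\<open>B\<close> accounts for the upper bound on \<open>ln \<rho>\<close> and
    \<open>\<bar>ln (w p)\<bar>\<close> for the lower one.\<close>
  define c where "c = 1 + B + \<bar>ln (w p)\<bar>"
  have "0 \<le> B" using B[of 0] by linarith
  then have c: "1 \<le> c" by (simp add: c_def)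
  have ln_le: "1 + \<bar>ln (\<rho> y)\<bar> \<le> c * (1 + \<bar>ln (\<phi> (y - x p))\<bar>)" for y
  proof -
    have "ln (w p * \<phi> (y - x p)) \<le> ln (\<rho> y)"
      using ge[of y] \<rho>_pos[of y] wp \<phi>_pos[of "y - x p"] by (subst ln_le_cancel_iff) auto
    then have "ln (w p) + ln (\<phi> (y - x p)) \<le> ln (\<rho> y)"
      using wp \<phi>_pos[of "y - x p"] by (simp add: ln_mult)
    moreover have "ln (\<rho> y) \<le> B" using ln_le_minus_one[OF \<rho>_pos, of y] B(2)[of y] by linarith
    ultimately have "1 + \<bar>ln (\<rho> y)\<bar> \<le> c + \<bar>ln (\<phi> (y - x p))\<bar>"
      using \<open>0 \<le> B\<close> unfolding c_def by linarith
    also have "\<dots> \<le> c + c * \<bar>ln (\<phi> (y - x p))\<bar>"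
      using mult_right_mono[OF c, of "\<bar>ln (\<phi> (y - x p))\<bar>"] by simp
    finally show ?thesis by (simp add: distrib_left)
  qed
  show ?thesis
  proof
    show "DERIV H_log (\<rho> y) :> ln (\<rho> y) + 1" for y
      unfolding H_log_def using \<rho>_pos[of y] by (auto intro!: derivative_eq_intros)
    have "\<bar>ln (\<rho> y) + 1\<bar> \<le> 1 * (1 + \<bar>ln (\<rho> y)\<bar>)" for y by simp
    then show "\<exists>C. \<forall>y. \<bar>ln (\<rho> y) + 1\<bar> \<le> C * (1 + \<bar>ln (\<rho> y)\<bar>)" by blast
    show "\<exists>C. \<forall>y t. \<bar>t\<bar> \<le> M \<longrightarrow> \<bar>H_log (\<rho> y + t) - H_log (\<rho> y)\<bar> \<le> C * \<bar>t\<bar> * (1 + \<bar>ln (\<rho> y)\<bar>)" for M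
      using H_log_increment[OF \<rho>_pos] by blast
    show "\<exists>g. integrable lborel g \<and>
        (\<forall>y z. norm z \<le> R \<longrightarrow> (\<phi> (y + z) + norm (grad \<phi> (y + z))) * (1 + \<bar>ln (\<rho> y)\<bar>) \<le> g y)" for R
    proof -
      \<comment> \<open>The radius has to admit both the translate \<open>z\<close> and
        \<open>- x p\<close>, where the logarithm is evaluated.\<close>
      from moll(3) obtain g where g: "integrable lborel g"
        "\<And>y z v. norm z \<le> max R (norm (x p)) \<and> norm v \<le> max R (norm (x p)) \<Longrightarrow>
          (\<phi> (y + z) + norm (grad \<phi> (y + z))) * (1 + \<bar>ln (\<phi> (y + v))\<bar>) \<le> g y"
        unfolding log_regular_mollifier_def by blast
      have "(\<phi> (y + z) + norm (grad \<phi> (y + z))) * (1 + \<bar>ln (\<rho> y)\<bar>) \<le> c * g y" if "norm z \<le> R" for y z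
      proof -
        let ?s = "\<phi> (y + z) + norm (grad \<phi> (y + z))"
        have "?s * (1 + \<bar>ln (\<rho> y)\<bar>) \<le> ?s * (c * (1 + \<bar>ln (\<phi> (y - x p))\<bar>))"
          using ln_le \<phi>_pos by (intro mult_left_mono add_nonneg_nonneg) (auto intro: less_imp_le)
        also have "\<dots> = c * (?s * (1 + \<bar>ln (\<phi> (y + - x p))\<bar>))" by simp
        also have "\<dots> \<le> c * g y"
          using c that by (intro mult_left_mono g(2)) auto
        finally show ?thesis .
      qed
      with g(1) show ?thesis by (intro exI[of _ "\<lambda>y. c * g y"]) auto
    qed
    show "H_log \<in> borel_measurable borel" unfolding H_log_def by measurable
  qed (use moll in \<open>simp_all add: \<rho>_def H_log_def\<close>)
qed

text \<open>\<open>grad\<close> and \<open>variational_derivative\<close> are definite descriptions,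
  so the differentiability and \<open>is_variational_derivative\<close> clauses certify that the
  identities concern genuine derivatives. Uniqueness evaluates both gradients to \<open>g\<close>,
  up to the factor \<open>w p\<close>.\<close>

lemma variational_gradient:
  fixes E :: "'a::euclidean_space distr \<Rightarrow> real"
  assumes "is_variational_derivative E (atomic N w x) D" and "GDERIV D (x p) :> g"
    and "GDERIV (\<lambda>y. E (atomic N w (x(p := y)))) (x p) :> w p *\<^sub>R g" and "w p > 0"
  shows "is_variational_derivative E (atomic N w x) (variational_derivative E (atomic N w x)) \<and>
    (\<lambda>y. E (atomic N w (x(p := y)))) differentiable (at (x p)) \<and>
    variational_derivative E (atomic N w x) differentiable (at (x p)) \<and>
    (1 / w p) *\<^sub>R grad (\<lambda>y. E (atomic N w (x(p := y)))) (x p)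
      = grad (variational_derivative E (atomic N w x)) (x p) \<and>
    grad (variational_derivative E (atomic N w x)) (x p) = g"
  using assms GDERIV_differentiable[OF assms(2)] GDERIV_differentiable[OF assms(3)]
  by (simp add: variational_derivative_eq[OF assms(1)] grad_eq[OF assms(2)] grad_eq[OF assms(3)])

lemma GDERIV_potential_variation:
  fixes V W :: "'a::euclidean_space \<Rightarrow> real"
  assumes V: "V differentiable (at z)" and W: "\<And>z. W differentiable (at z)"
  shows "GDERIV (\<lambda>y. V y + (\<Sum>q=1..N. w q * W (y - x q))) z :>
    grad V z + (\<Sum>q=1..N. w q *\<^sub>R grad W (z - x q))"
proof -
  have "((\<lambda>y. W (y - x q)) has_derivative (\<lambda>h. inner h (grad W (z - x q)))) (at z)" for q
    by (rule has_derivative_grad_shift[OF W])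
  then have "((\<lambda>y. V y + (\<Sum>q=1..N. w q * W (y - x q))) has_derivative
      (\<lambda>h. inner h (grad V z) + (\<Sum>q=1..N. w q * inner h (grad W (z - x q))))) (at z)"
    using GDERIV_grad[OF V] unfolding gderiv_def
    by (intro has_derivative_add has_derivative_sum has_derivative_mult_right)
  then show ?thesis
    unfolding gderiv_def by (simp add: inner_add_right inner_sum_right)
qed

context mollified_entropy
begin

lemma entropy_variational_gradient:
  assumes "p \<in> {1..N}" "w p > 0"
  defines "E \<equiv> \<lambda>f. LINT y|lborel. H (convol f \<phi> y)"
  shows "is_variational_derivative E (atomic N w x) (variational_derivative E (atomic N w x)) \<and>
    (\<lambda>y. E (atomic N w (x(p := y)))) differentiable (at (x p)) \<and>
    variational_derivative E (atomic N w x) differentiable (at (x p)) \<and>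
    (1 / w p) *\<^sub>R grad (\<lambda>y. E (atomic N w (x(p := y)))) (x p)
      = grad (variational_derivative E (atomic N w x)) (x p) \<and>
    grad (variational_derivative E (atomic N w x)) (x p)
      = (LINT y|lborel. a y *\<^sub>R grad \<phi> (x p - y))"
  unfolding E_def
  by (rule variational_gradient[OF is_variational_derivative_entropy GDERIV_entropy_variation
        GDERIV_entropy[OF assms(1)] assms(2)])

lemma energy_A_variational_gradient:
  fixes V W :: "'a \<Rightarrow> real"
  assumes p: "p \<in> {1..N}" "w p > 0"
    and V: "\<And>z. V differentiable (at z)"
    and W: "\<And>z. W differentiable (at z)" and even: "\<And>z. W (- z) = W z"
  defines "E \<equiv> energy_A H V W \<phi>"
  shows "is_variational_derivative E (atomic N w x) (variational_derivative E (atomic N w x)) \<and>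
    (\<lambda>y. E (atomic N w (x(p := y)))) differentiable (at (x p)) \<and>
    variational_derivative E (atomic N w x) differentiable (at (x p)) \<and>
    (1 / w p) *\<^sub>R grad (\<lambda>y. E (atomic N w (x(p := y)))) (x p)
      = grad (variational_derivative E (atomic N w x)) (x p) \<and>
    grad (variational_derivative E (atomic N w x)) (x p)
      = (LINT y|lborel. a y *\<^sub>R grad \<phi> (x p - y)) + grad V (x p) + (\<Sum>q=1..N. w q *\<^sub>R grad W (x p - x q))"
proof -
  \<comment> \<open>The entropy is separated from the potential terms so that additivity of
    variational derivatives applies.\<close>
  have E: "E = (\<lambda>f. (LINT y|lborel. H (convol f \<phi> y)) + (f V + 1 / 2 * f (convol f W)))"
    by (simp add: E_def energy_A_def fun_eq_iff)
  have cont: "continuous_on UNIV V" "continuous_on UNIV W"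
    using V W by (meson continuous_at_imp_continuous_on differentiable_imp_continuous_within)+
  have g: "(LINT y|lborel. a y *\<^sub>R grad \<phi> (x p - y)) + grad V (x p) + (\<Sum>q=1..N. w q *\<^sub>R grad W (x p - x q)) =
      (LINT y|lborel. a y *\<^sub>R grad \<phi> (x p - y)) + (grad V (x p) + (\<Sum>q=1..N. w q *\<^sub>R grad W (x p - x q)))"
    by (rule add.assoc)
  show ?thesis
    unfolding E g
  proof (rule variational_gradient[OF is_variational_derivative_add[OF is_variational_derivative_entropy
          is_variational_derivative_potential[OF cont even]]
        GDERIV_add[OF GDERIV_entropy_variation GDERIV_potential_variation[OF V W]] _ p(2)])
    show "GDERIV (\<lambda>y. (LINT z|lborel. H (convol (atomic N w (x(p := y))) \<phi> z)) +
        (atomic N w (x(p := y)) V + 1 / 2 * atomic N w (x(p := y)) (convol (atomic N w (x(p := y))) W))) (x p) :>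
      w p *\<^sub>R ((LINT y|lborel. a y *\<^sub>R grad \<phi> (x p - y)) +
        (grad V (x p) + (\<Sum>q=1..N. w q *\<^sub>R grad W (x p - x q))))"
      unfolding scaleR_add_right[of "w p" "LINT y|lborel. a y *\<^sub>R grad \<phi> (x p - y)"]
      by (rule GDERIV_add[OF GDERIV_entropy[OF p(1)]], rule GDERIV_potential[OF V W even p(1)])
  qed
qed

end

theorem corollary2p2:
  fixes \<phi> :: "real \<Rightarrow> 'a::euclidean_space \<Rightarrow> real" and \<epsilon> m :: real
    and V W :: "'a \<Rightarrow> real"
    and N p :: nat and w :: "nat \<Rightarrow> real" and x :: "nat \<Rightarrow> 'a"
  assumes "\<epsilon> > 0" and "m > 1"
    and "symmetric_mollifier (\<phi> \<epsilon>)" and "regular_mollifier (\<phi> \<epsilon>)"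
    and "\<And>z. V differentiable (at z)"
    and "\<And>z. W differentiable (at z)" and "\<And>z. W (- z) = W z"
    and "\<And>q. q \<in> {1..N} \<Longrightarrow> w q > 0"
    and "p \<in> {1..N}"
  shows "let fN = atomic N w x;
        E_A_log = energy_A H_log V W (\<phi> \<epsilon>);
        E_A_pow = energy_A (H_pow m) V W (\<phi> \<epsilon>);
        E_L = energy_L (\<phi> \<epsilon>)
      in
      (log_regular_mollifier (\<phi> \<epsilon>) \<longrightarrow>
        is_variational_derivative E_A_log fN (variational_derivative E_A_log fN) \<and>
        (\<lambda>y. E_A_log (atomic N w (x(p := y)))) differentiable (at (x p)) \<and>
        variational_derivative E_A_log fN differentiable (at (x p)) \<and>
        (1 / w p) *\<^sub>R grad (\<lambda>y. E_A_log (atomic N w (x(p := y)))) (x p)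
          = grad (variational_derivative E_A_log fN) (x p) \<and>
        grad (variational_derivative E_A_log fN) (x p)
          = h_log (\<phi> \<epsilon>) N w x (x p) + grad V (x p) + (\<Sum>q=1..N. w q *\<^sub>R grad W (x p - x q))) \<and>
      (is_variational_derivative E_A_pow fN (variational_derivative E_A_pow fN) \<and>
        (\<lambda>y. E_A_pow (atomic N w (x(p := y)))) differentiable (at (x p)) \<and>
        variational_derivative E_A_pow fN differentiable (at (x p)) \<and>
        (1 / w p) *\<^sub>R grad (\<lambda>y. E_A_pow (atomic N w (x(p := y)))) (x p)
          = grad (variational_derivative E_A_pow fN) (x p) \<and>
        grad (variational_derivative E_A_pow fN) (x p)
          = h_pow m (\<phi> \<epsilon>) N w x (x p) + grad V (x p) + (\<Sum>q=1..N. w q *\<^sub>R grad W (x p - x q))) \<and>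
      (log_regular_mollifier (\<phi> \<epsilon>) \<longrightarrow>
        is_variational_derivative E_L fN (variational_derivative E_L fN) \<and>
        (\<lambda>y. E_L (atomic N w (x(p := y)))) differentiable (at (x p)) \<and>
        variational_derivative E_L fN differentiable (at (x p)) \<and>
        (1 / w p) *\<^sub>R grad (\<lambda>y. E_L (atomic N w (x(p := y)))) (x p)
          = grad (variational_derivative E_L fN) (x p) \<and>
        grad (variational_derivative E_L fN) (x p)
          = h_log (\<phi> \<epsilon>) N w x (x p))"
proof -
  let ?\<rho> = "\<lambda>y. \<Sum>q=1..N. w q * \<phi> \<epsilon> (y - x q)"
  have wp: "w p > 0" using assms(8,9) by blast
  have E_L: "energy_L (\<phi> \<epsilon>) = (\<lambda>f. LINT y|lborel. H_log (convol f (\<phi> \<epsilon>) y))"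
    by (simp add: energy_L_def fun_eq_iff)
  interpret pow: mollified_entropy "\<phi> \<epsilon>" "H_pow m" N w x ?\<rho>
      "\<lambda>y. m / (m - 1) * ?\<rho> y powr (m - 1)" "\<lambda>_. 1"
    using mollified_entropy_pow[OF assms(2-4,8)] .
  have h_pow: "(LINT y|lborel. (m / (m - 1) * ?\<rho> y powr (m - 1)) *\<^sub>R grad (\<phi> \<epsilon>) (x p - y)) =
      h_pow m (\<phi> \<epsilon>) N w x (x p)"
    unfolding h_pow_def scaleR_scaleR[symmetric] by (rule integral_scaleR_right)
  have log: "mollified_entropy (\<phi> \<epsilon>) H_log N w x ?\<rho> (\<lambda>y. ln (?\<rho> y) + 1) (\<lambda>y. 1 + \<bar>ln (?\<rho> y)\<bar>)"
    and h_log: "(LINT y|lborel. (ln (?\<rho> y) + 1) *\<^sub>R grad (\<phi> \<epsilon>) (x p - y)) = h_log (\<phi> \<epsilon>) N w x (x p)"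
    if "log_regular_mollifier (\<phi> \<epsilon>)"
  proof -
    show "mollified_entropy (\<phi> \<epsilon>) H_log N w x ?\<rho> (\<lambda>y. ln (?\<rho> y) + 1) (\<lambda>y. 1 + \<bar>ln (?\<rho> y)\<bar>)"
      using mollified_entropy_log[OF assms(3,4) that assms(8,9)] .
    then interpret log: mollified_entropy "\<phi> \<epsilon>" H_log N w x ?\<rho>
      "\<lambda>y. ln (?\<rho> y) + 1" "\<lambda>y. 1 + \<bar>ln (?\<rho> y)\<bar>" .
    have [measurable]: "?\<rho> \<in> borel_measurable borel" by (rule log.\<rho>_measurable)
    have ln_meas: "(\<lambda>y. ln (?\<rho> y)) \<in> borel_measurable borel" by measurable
    \<comment> \<open>The weight \<open>ln + 1\<close> is split into two parts, each bounded by the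
      weight \<open>1 + \<bar>ln\<bar>\<close> of the density; the constant part integrates to zero
      against the gradient.\<close>
    have int: "integrable lborel (\<lambda>y. ln (?\<rho> y) *\<^sub>R grad (\<phi> \<epsilon>) (x p - y))"
      by (rule log.integrable_convolution(2)[OF ln_meas, where C = 1]) simp
    have int': "integrable lborel (\<lambda>y. 1 *\<^sub>R grad (\<phi> \<epsilon>) (x p - y))"
      by (rule log.integrable_convolution(2)[OF borel_measurable_const, where C = 1]) simp
    show "(LINT y|lborel. (ln (?\<rho> y) + 1) *\<^sub>R grad (\<phi> \<epsilon>) (x p - y)) = h_log (\<phi> \<epsilon>) N w x (x p)"
      using Bochner_Integration.integral_add[OF int int'] log.integral_grad_eq_0[of "x p"]
      by (simp add: h_log_def scaleR_add_left)
  qed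
  note pow_result = pow.energy_A_variational_gradient[OF assms(9) wp assms(5-7), unfolded h_pow]
  show ?thesis
  proof (cases "log_regular_mollifier (\<phi> \<epsilon>)")
    case True
    show ?thesis
      unfolding Let_def E_L
      using mollified_entropy.energy_A_variational_gradient[OF log[OF True] assms(9) wp assms(5-7),
          unfolded h_log[OF True]]
        mollified_entropy.entropy_variational_gradient[OF log[OF True] assms(9) wp,
          unfolded h_log[OF True]]
        pow_result
      by blast
  next
    \<comment> \<open>Both logarithmic conjuncts are vacuous here.\<close>
    case False
    then show ?thesis unfolding Let_def using pow_result by blast
  qed
qed

end
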